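(* Let $n\ge1$ and let $\hat\Xi:H_{\infty-}^n\times H_{\infty-}\to\mathbb{C}$ be a function satisfying the following two properties. (O$_1$) For any elements $\xi^1_1,\dots,\xi^n_1,\xi^1_2,\dots,\xi^n_2,\eta_1,\eta_2$ of $H_{\infty-}$, the map $$(z_1,\dots,z_n,w)\mapsto\hat\Xi(z_1\xi_1^1+\xi_2^1,\dots,z_n\xi_1^n+\xi_2^n,\,w\eta_1+\eta_2)$$ is an entire holomorphic map from $\mathbb{C}^n\times\mathbb{C}$ into $\mathbb{C}$. (O$_2$) For all $k>0$ and $K>0$ there exist numbers $C>0$, $k_1>k$ and $K_1>0$ such that for all $\xi^1,\dots,\xi^n,\eta\in H_{\infty-}$ $$|\hat\Xi(\xi^1,\dots,\xi^n,\eta)|^2\le C\exp\Big[K_1\sum_{i=1}^n\|\xi^i\|_{k_1}^2+K\|\eta\|_{-k}^2\Big].$$ Then $\hat\Xi$ is the symbol of an element $\Xi$ of $L(W_{\infty-}^n,W_{\infty-})$, that is, there is a continuous $n$-multilinear map $\Xi$ from $W_{\infty-}^n$ into $W_{\infty-}$ with $\hat\Xi(\xi^1,\dots,\xi^n,\eta)=\langle\Xi(\phi_{\xi^1},\dots,\phi_{\xi^n}),\phi_\eta\rangle_0$ for all $\xi^1,\dots,\xi^n,\eta\in H_{\infty-}$. Moreover, the moduli of continuity of $\Xi$ can be estimated in terms of the data in (O$_2$): for every $(k',C')$ with $k',C'>0$ there are $k_2,C_2,K_2>0$, depending only on $n$, $(k',C')$ and the constants $C,k_1,K_1$ (as functions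 of $k,K$) in (O$_2$), such that $$\|\Xi(\phi^1,\dots,\phi^n)\|_{k',C'}\le K_2\prod_{i=1}^n\|\phi^i\|_{k_2,C_2}\qquad\text{for all }\phi^1,\dots,\phi^n\in W_{\infty-}.$$
   Context: All spaces are complex. Let $H=L^2(\mathbb{R},dt)$ (complexified) with orthonormal basis $(e_j)_{j\ge0}$ of (real) eigenvectors of $\Delta=1+t^2-d^2/dt^2$, with eigenvalues $\mu_j=2j+2$. For $k\in\mathbb{R}$ and $f=\sum_j\lambda_je_j$, put $\|f\|_k^2=\sum_j|\lambda_j|^2\mu_j^{2k}$; $H_k$ is the space of such series with finite norm, and $H_{\infty-}=\bigcap_{k\ge0}H_k$. For $f=\sum\lambda_je_j$, $g=\sum\mu'_je_j$, $\langle f,g\rangle_0=\sum_j\lambda_j\mu'_j$ (complex bilinear extension of the real inner product). A multi-index is $A=((i_1,r_1),\dots,(i_m,r_m))$ with integers $0\le i_1<\dots<i_m$ and $r_j>0$ integers (the empty one allowed); $|A|=\sum_jr_j$, $\|A\|=\prod_j(2i_j+2)^{r_j}$. $e_A$ is the symmetric tensor product $\hat\otimes_j e_{i_j}^{\otimes r_j}$, where $\hat\otimes$ is the symmetrization (average over permutations) of the tensor product. For $k>0,C>0$, $W_{k,C}$ is the space of series $\phi=\sum_A\lambda_Ae_A$, $\lambda_A\in\mathbb{C}$, with $\|\phi\|_{k,C}^2=\sum_A|\lambda_A|^2C^{2|A|}\|A\|^{2k}|A|!<\infty$. The Hida test space is $W_{\infty-}=\bigcap_{k>0,C>0}W_{k,C}$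 with the topology defined by all these norms. For $\xi\in H_{\infty-}$ the coherent vector is $\phi_\xi=\sum_{n\in\mathbb{N}}\xi^{\otimes n}/n!\in W_{\infty-}$. $\langle\cdot,\cdot\rangle_0$ on $W_{\infty-}$ is the complex bilinear pairing of the symmetric Fock space over $H$: $\langle e_A,e_B\rangle_0=0$ if $A\ne B$ and $\langle e_A,e_A\rangle_0=\prod_jr_j!$, so that $\langle\phi_\xi,\phi_\eta\rangle_0=\exp\langle\xi,\eta\rangle_0$. $L(W_{\infty-}^n,W_{\infty-})$ is the space of continuous $n$-multilinear maps from $W_{\infty-}$ into $W_{\infty-}$, i.e. multilinear $\Xi$ such that for every $(k',C')$ there is $(k_2,C_2,K_2)$ with $\|\Xi(\phi^1,\dots,\phi^n)\|_{k',C'}\le K_2\prod_i\|\phi^i\|_{k_2,C_2}$. The symbol of $\Xi\in L(W^n_{\infty-},W_{\infty-})$ is the function $\hat\Xi(\xi^1,\dots,\xi^n,\eta)=\langle\Xi(\phi_{\xi^1},\dots,\phi_{\xi^n}),\phi_\eta\rangle_0$ on $H_{\infty-}^n\times H_{\infty-}$. *)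

theory Defs
  imports "HOL-Analysis.Analysis" "HOL-Combinatorics.Multiset_Permutations"
begin

text \<open>
  A series \<open>f = (\<Sum>j. \<lambda>\<^sub>j e\<^sub>j)\<close> over the orthonormal eigenbasis of \<open>1 + t\<^sup>2 - d\<^sup>2/dt\<^sup>2\<close> on \<open>L\<^sup>2(\<real>)\<close>
  is represented by its coefficient family \<open>j \<mapsto> \<lambda>\<^sub>j\<close>; for \<open>k < 0\<close> the elements of \<open>H\<^sub>k\<close> are
  formal series anyway. Multi-indices \<open>A = ((i\<^sub>1,r\<^sub>1),\<dots>,(i\<^sub>m,r\<^sub>m))\<close> are finite multisets over \<open>nat\<close>,
  \<open>r\<^sub>j\<close> being the multiplicity of \<open>i\<^sub>j\<close>, so \<open>|A| = size A\<close>; a series \<open>(\<Sum>A. \<lambda>\<^sub>A e\<^sub>A)\<close> is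
  represented by \<open>A \<mapsto> \<lambda>\<^sub>A\<close>.
\<close>

type_synonym hseq = "nat \<Rightarrow> complex"
type_synonym fock = "nat multiset \<Rightarrow> complex"

definition eigval :: "nat \<Rightarrow> real" where
  "eigval j = 2 * real j + 2"

definition H_space :: "real \<Rightarrow> hseq set" where
  "H_space k = {f. (\<lambda>j. (cmod (f j))\<^sup>2 * eigval j powr (2 * k)) summable_on UNIV}"

definition H_norm :: "real \<Rightarrow> hseq \<Rightarrow> real" where
  "H_norm k f = sqrt (\<Sum>\<^sub>\<infinity>j. (cmod (f j))\<^sup>2 * eigval j powr (2 * k))"

definition H_inf :: "hseq set" where
  "H_inf = (\<Inter>k\<in>{0..}. H_space k)"

definition mi_weight :: "nat multiset \<Rightarrow> real" where
  "mi_weight A = (\<Prod>i\<in>#A. eigval i)"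

definition mi_fact :: "nat multiset \<Rightarrow> nat" where
  "mi_fact A = (\<Prod>i\<in>set_mset A. fact (count A i))"

definition W_term :: "real \<Rightarrow> real \<Rightarrow> fock \<Rightarrow> nat multiset \<Rightarrow> real" where
  "W_term k C \<phi> A =
     (cmod (\<phi> A))\<^sup>2 * C ^ (2 * size A) * mi_weight A powr (2 * k) * fact (size A)"

definition W_space :: "real \<Rightarrow> real \<Rightarrow> fock set" where
  "W_space k C = {\<phi>. W_term k C \<phi> summable_on UNIV}"

definition W_norm :: "real \<Rightarrow> real \<Rightarrow> fock \<Rightarrow> real" where
  "W_norm k C \<phi> = sqrt (\<Sum>\<^sub>\<infinity>A. W_term k C \<phi> A)"

definition W_inf :: "fock set" where
  "W_inf = (\<Inter>k\<in>{0<..}. \<Inter>C\<in>{0<..}. W_space k C)"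

text \<open>
  The bilinear pairing determined by \<open>\<langle>e\<^sub>A, e\<^sub>B\<rangle> = 0\<close> for \<open>A \<noteq> B\<close> and
  \<open>\<langle>e\<^sub>A, e\<^sub>A\<rangle> = (\<Prod>j. r\<^sub>j!)\<close>; there is no complex conjugation.
\<close>

definition pairing :: "fock \<Rightarrow> fock \<Rightarrow> complex" where
  "pairing \<phi> \<psi> = (\<Sum>\<^sub>\<infinity>A. \<phi> A * \<psi> A * of_nat (mi_fact A))"

text \<open>
  The coherent vector \<open>(\<Sum>n. \<xi>\<^sup>\<otimes>\<^sup>n / n!)\<close>. Expanding the tensor power gives
  \<open>\<xi>\<^sup>\<otimes>\<^sup>n = (\<Sum>l. \<xi>\<^bsub>l1\<^esub> \<cdots> \<xi>\<^bsub>ln\<^esub> e\<^bsub>l1\<^esub> \<otimes> \<cdots> \<otimes> e\<^bsub>ln\<^esub>)\<close> over the lists \<open>l\<close> of length \<open>n\<close>.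
  Since \<open>\<xi>\<^sup>\<otimes>\<^sup>n\<close> is symmetric it equals its symmetrization, which turns the summand for \<open>l\<close>
  into a multiple of \<open>e\<^sub>A\<close> for \<open>A = mset l\<close>. Hence the coefficient at \<open>e\<^sub>A\<close> is the
  sum over all lists with underlying multiset \<open>A\<close>.
\<close>

definition coherent :: "hseq \<Rightarrow> fock" where
  "coherent \<xi> A = (\<Sum>l\<in>permutations_of_multiset A. \<Prod>i\<leftarrow>l. \<xi> i) / fact (size A)"

lemma coherent_eq:
  "coherent \<xi> A = (\<Prod>i\<in>set_mset A. \<xi> i ^ count A i / fact (count A i))"
proof -
  have P: "(\<Prod>i\<leftarrow>l. \<xi> i) = (\<Prod>i\<in>set_mset A. \<xi> i ^ count A i)"
    if "l \<in> permutations_of_multiset A" for l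
  proof -
    from that have l: "mset l = A" by (simp add: permutations_of_multiset_def)
    have "(\<Prod>i\<leftarrow>l. \<xi> i) = (\<Prod>i\<in>#A. \<xi> i)"
      by (simp add: l[symmetric] prod_mset_prod_list flip: mset_map)
    then show ?thesis by (simp add: image_prod_mset_multiplicity)
  qed
  have "card (permutations_of_multiset A) * (\<Prod>x\<in>set_mset A. fact (count A x)) = fact (size A)"
    by (rule card_permutations_of_multiset_aux)
  then have c: "(of_nat (card (permutations_of_multiset A)) :: complex)
      * (\<Prod>x\<in>set_mset A. fact (count A x)) = fact (size A)"
    by (metis (mono_tags, lifting) of_nat_fact of_nat_mult of_nat_prod prod.cong)
  have nz: "(\<Prod>x\<in>set_mset A. fact (count A x) :: complex) \<noteq> 0" by simp
  have "coherent \<xi> A = of_nat (card (permutations_of_multiset A))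
      * (\<Prod>i\<in>set_mset A. \<xi> i ^ count A i) / fact (size A)"
    unfolding coherent_def by (simp add: P)
  with nz show ?thesis
    by (simp add: c[symmetric] prod_dividef field_simps)
qed

text \<open>
  The \<open>n\<close>-tuples are indexed by a finite type \<open>'n\<close> with \<open>n = CARD('n) \<ge> 1\<close>.
  Maps are total functions on coefficient families and matter only on \<open>H_inf\<close> and \<open>W_inf\<close>.
\<close>

definition multilinear_on_W :: "(('n::finite \<Rightarrow> fock) \<Rightarrow> fock) \<Rightarrow> bool" where
  "multilinear_on_W \<Xi> \<longleftrightarrow>
     (\<forall>\<phi> i \<psi> \<theta> a b. (\<forall>j. \<phi> j \<in> W_inf) \<longrightarrow> \<psi> \<in> W_inf \<longrightarrow> \<theta> \<in> W_inf \<longrightarrow>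
        \<Xi> (\<phi>(i := (\<lambda>A. a * \<psi> A + b * \<theta> A)))
          = (\<lambda>A. a * \<Xi> (\<phi>(i := \<psi>)) A + b * \<Xi> (\<phi>(i := \<theta>)) A))"

definition W_bound ::
    "(('n::finite \<Rightarrow> fock) \<Rightarrow> fock) \<Rightarrow> real \<Rightarrow> real \<Rightarrow> real \<Rightarrow> real \<Rightarrow> real \<Rightarrow> bool" where
  "W_bound \<Xi> k' C' k\<^sub>2 C\<^sub>2 K\<^sub>2 \<longleftrightarrow>
     (\<forall>\<phi>. (\<forall>i. \<phi> i \<in> W_inf) \<longrightarrow> W_norm k' C' (\<Xi> \<phi>) \<le> K\<^sub>2 * (\<Prod>i\<in>UNIV. W_norm k\<^sub>2 C\<^sub>2 (\<phi> i)))"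

definition L_W :: "(('n::finite \<Rightarrow> fock) \<Rightarrow> fock) set" where
  "L_W = {\<Xi>. (\<forall>\<phi>. (\<forall>i. \<phi> i \<in> W_inf) \<longrightarrow> \<Xi> \<phi> \<in> W_inf) \<and> multilinear_on_W \<Xi> \<and>
     (\<forall>k'>0. \<forall>C'>0. \<exists>k\<^sub>2>0. \<exists>C\<^sub>2>0. \<exists>K\<^sub>2>0. W_bound \<Xi> k' C' k\<^sub>2 C\<^sub>2 K\<^sub>2)}"

definition symbol :: "(('n::finite \<Rightarrow> fock) \<Rightarrow> fock) \<Rightarrow> ('n \<Rightarrow> hseq) \<Rightarrow> hseq \<Rightarrow> complex" where
  "symbol \<Xi> \<xi> \<eta> = pairing (\<Xi> (\<lambda>i. coherent (\<xi> i))) (coherent \<eta>)"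

definition is_symbol_of ::
    "(('n::finite \<Rightarrow> hseq) \<Rightarrow> hseq \<Rightarrow> complex) \<Rightarrow> (('n \<Rightarrow> fock) \<Rightarrow> fock) \<Rightarrow> bool" where
  "is_symbol_of F \<Xi> \<longleftrightarrow>
     (\<forall>\<xi> \<eta>. (\<forall>i. \<xi> i \<in> H_inf) \<longrightarrow> \<eta> \<in> H_inf \<longrightarrow> F \<xi> \<eta> = symbol \<Xi> \<xi> \<eta>)"

text \<open>
  Holomorphy in several variables: a Frechet derivative exists at every point and is complex linear.
\<close>

definition entire :: "((complex ^ 'n::finite) \<times> complex \<Rightarrow> complex) \<Rightarrow> bool" where
  "entire G \<longleftrightarrow>
     (\<forall>p. \<exists>D. (G has_derivative D) (at p) \<and> (\<forall>c v w. D (c *s v, c * w) = c * D (v, w)))"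

definition O1 :: "(('n::finite \<Rightarrow> hseq) \<Rightarrow> hseq \<Rightarrow> complex) \<Rightarrow> bool" where
  "O1 F \<longleftrightarrow>
     (\<forall>\<xi>\<^sub>1 \<xi>\<^sub>2 \<eta>\<^sub>1 \<eta>\<^sub>2. (\<forall>i. \<xi>\<^sub>1 i \<in> H_inf) \<longrightarrow> (\<forall>i. \<xi>\<^sub>2 i \<in> H_inf) \<longrightarrow> \<eta>\<^sub>1 \<in> H_inf \<longrightarrow> \<eta>\<^sub>2 \<in> H_inf \<longrightarrow>
        entire (\<lambda>(z, w). F (\<lambda>i j. z $ i * \<xi>\<^sub>1 i j + \<xi>\<^sub>2 i j) (\<lambda>j. w * \<eta>\<^sub>1 j + \<eta>\<^sub>2 j)))"

definition symbol_bound ::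
    "(('n::finite \<Rightarrow> hseq) \<Rightarrow> hseq \<Rightarrow> complex) \<Rightarrow> real \<Rightarrow> real \<Rightarrow> real \<Rightarrow> real \<Rightarrow> real \<Rightarrow> bool" where
  "symbol_bound F k K C k\<^sub>1 K\<^sub>1 \<longleftrightarrow>
     (\<forall>\<xi> \<eta>. (\<forall>i. \<xi> i \<in> H_inf) \<longrightarrow> \<eta> \<in> H_inf \<longrightarrow>
        (cmod (F \<xi> \<eta>))\<^sup>2
          \<le> C * exp (K\<^sub>1 * (\<Sum>i\<in>UNIV. (H_norm k\<^sub>1 (\<xi> i))\<^sup>2) + K * (H_norm (- k) \<eta>)\<^sup>2))"

definition O2 :: "(('n::finite \<Rightarrow> hseq) \<Rightarrow> hseq \<Rightarrow> complex) \<Rightarrow> bool" where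
  "O2 F \<longleftrightarrow> (\<forall>k>0. \<forall>K>0. \<exists>C>0. \<exists>k\<^sub>1>k. \<exists>K\<^sub>1>0. symbol_bound F k K C k\<^sub>1 K\<^sub>1)"

text \<open>
  The condition \<open>O2\<close> with prescribed constants, given as functions of \<open>k\<close> and \<open>K\<close>.
\<close>

definition O2_data ::
    "(real \<Rightarrow> real \<Rightarrow> real) \<Rightarrow> (real \<Rightarrow> real \<Rightarrow> real) \<Rightarrow> (real \<Rightarrow> real \<Rightarrow> real) \<Rightarrow>
     (('n::finite \<Rightarrow> hseq) \<Rightarrow> hseq \<Rightarrow> complex) \<Rightarrow> bool" where
  "O2_data C k\<^sub>1 K\<^sub>1 F \<longleftrightarrow>
     (\<forall>k>0. \<forall>K>0. C k K > 0 \<and> k\<^sub>1 k K > k \<and> K\<^sub>1 k K > 0 \<and>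
        symbol_bound F k K (C k K) (k\<^sub>1 k K) (K\<^sub>1 k K))"

end

theory Submission
  imports Defs "HOL-Complex_Analysis.Complex_Analysis"
begin

text \<open>
  Read all arguments of \<open>F\<close> as one sequence of complex variables, with coordinates \<open>x\<^sub>v\<close>. Conditions
  \<open>O1\<close> and \<open>O2\<close> make \<open>F\<close> separately entire with a diagonal Gaussian bound
  \<open>|F x|\<^sup>2 \<le> C exp (\<Sum>v. c\<^sub>v |x\<^sub>v|\<^sup>2)\<close>, and optimising the Cauchy estimates over polydiscs bounds the
  Taylor coefficients by \<open>|a\<^sub>A|\<^sup>2 \<le> C (e c)\<^sup>A / A!\<close>. This factorises over the arguments. The coefficients
  of \<open>\<Xi> \<phi>\<close> at \<open>e\<^sub>B\<close> are \<open>\<Sum>A. \<phi>(A) A! a\<^bsub>A,B\<^esub>\<close>; they are controlled by the Cauchy--Schwarz inequality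
  and \<open>\<Sum>A. |A|!/A! x\<^sup>A = 1 / (1 - \<Sum>j. x\<^sub>j)\<close>, where in the output variable \<open>\<Sum>j. x\<^sub>j < 1\<close> is achieved by
  taking \<open>k = k' + 1\<close> and \<open>K\<close> small in \<open>O2\<close>. The expansion of \<open>F\<close> holds for finitely supported
  arguments by iterating the one-variable Taylor series, and in general by truncation: along a
  complex line the Gaussian bound on ever larger discs forces convergence, as in Liouville's theorem.
\<close>

section \<open>Multinomial sums\<close>

text \<open>\<open>O1\<close> speaks only of finite-dimensional affine families and no topology on
  \<open>H_inf\<close> enters, so continuity of \<open>F\<close>, and its expansion at infinitely
  supported arguments, must be extracted from the growth bound. The coefficient bound alone does not
  make the power series converge on a weighted l2 space: already its terms of degree one would need
  the sum of sqrt(c_v) |x_v|. What helps is that the scale is nuclear: the numbers mu_j^(-2) are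
  summable, so raising k by 1 turns square sums into absolute ones. The operator is defined once,
  from the Taylor coefficients and without reference to (k', C'); each target norm uses another
  instance of \<open>O2\<close> for the same coefficients. In the output variable x_j = e K C'^2
  mu_j^(2(k'-k)), a multiple of mu_j^(-2) for k = k' + 1; the K that makes the sum 1/2 is
  \<open>target_const C'\<close>. In the input variables k1 and K1 come from \<open>O2\<close> and
  cannot be made small, but there the norm is free: |k1| + 1 and \<open>source_const K1\<close>
  compensate them.\<close>

lemma mi_fact_pos: "mi_fact A > 0"
  unfolding mi_fact_def by (simp add: prod_pos)

lemma mi_fact_nonzero [simp]: "mi_fact A \<noteq> 0"
  using mi_fact_pos[of A] by simp

lemma mi_fact_empty [simp]: "mi_fact {#} = 1"
  by (simp add: mi_fact_def)

lemma mi_fact_add_disjoint: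
  assumes "set_mset A \<inter> set_mset B = {}"
  shows "mi_fact (A + B) = mi_fact A * mi_fact B"
proof -
  have "mi_fact (A + B) = (\<Prod>i\<in>set_mset A \<union> set_mset B. fact (count (A + B) i))"
    by (simp add: mi_fact_def)
  also have "\<dots> = (\<Prod>i\<in>set_mset A. fact (count (A + B) i)) * (\<Prod>i\<in>set_mset B. fact (count (A + B) i))"
    by (rule prod.union_disjoint) (use assms in auto)
  also have "(\<Prod>i\<in>set_mset A. fact (count (A + B) i)) = mi_fact A"
    unfolding mi_fact_def by (rule prod.cong) (use assms in \<open>auto simp: not_in_iff disjoint_iff\<close>)
  also have "(\<Prod>i\<in>set_mset B. fact (count (A + B) i)) = mi_fact B"
    unfolding mi_fact_def
    by (rule prod.cong) (use assms in \<open>auto simp: not_in_iff disjoint_iff\<close>, metis not_in_iff add_0)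
  finally show ?thesis .
qed

lemma mi_fact_replicate [simp]: "mi_fact (replicate_mset m v) = fact m"
  by (cases "m = 0") (auto simp: mi_fact_def)

lemma mi_fact_image_inj:
  assumes "inj f"
  shows "mi_fact (image_mset f A) = mi_fact A"
proof -
  have "count (image_mset f A) (f i) = count A i" for i
    by (induction A) (use assms in \<open>auto simp: inj_eq\<close>)
  then show ?thesis
    unfolding mi_fact_def using assms
    by (simp add: prod.reindex inj_on_subset[OF assms])
qed

lemma mi_fact_mult_card_permutations:
  "card (permutations_of_multiset A) * mi_fact A = fact (size A)"
  unfolding mi_fact_def by (rule card_permutations_of_multiset_aux)

lemma mi_fact_le: "mi_fact A \<le> fact (size A)"
proof -
  have "card (permutations_of_multiset A) > 0"
    by (simp add: card_gt_0_iff)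
  then show ?thesis
    using mi_fact_mult_card_permutations[of A] by (metis Suc_leI mult_1 mult_le_mono1 One_nat_def)
qed

lemma sum_prod_lists_length:
  fixes x :: "'a \<Rightarrow> 'b::comm_semiring_1"
  assumes "finite F"
  shows "(\<Sum>l | set l \<subseteq> F \<and> length l = m. \<Prod>i\<leftarrow>l. x i) = (\<Sum>i\<in>F. x i) ^ m"
proof (induction m)
  case 0
  have "{l. set l \<subseteq> F \<and> length l = 0} = {[]}" by auto
  then show ?case by simp
next
  case (Suc m)
  let ?L = "{l. set l \<subseteq> F \<and> length l = m}"
  have eq: "{l. set l \<subseteq> F \<and> length l = Suc m} = (\<lambda>(i, l). i # l) ` (F \<times> ?L)"
    by (auto simp: length_Suc_conv image_iff)
  have "(\<Sum>l | set l \<subseteq> F \<and> length l = Suc m. \<Prod>i\<leftarrow>l. x i)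
      = (\<Sum>(i, l)\<in>F \<times> ?L. x i * (\<Prod>i\<leftarrow>l. x i))"
    unfolding eq by (subst sum.reindex) (auto simp: inj_on_def case_prod_unfold)
  also have "\<dots> = (\<Sum>i\<in>F. x i) * (\<Sum>l\<in>?L. \<Prod>i\<leftarrow>l. x i)"
    by (simp add: sum_product sum.cartesian_product)
  finally show ?case by (simp add: Suc.IH)
qed

text \<open>|A|!/A! counts the words with letter content A, so the left side is a sum over distinct
  words. The words of length m over a finite alphabet contribute the m-th power of the sum of x, and
  a geometric series remains.\<close>

lemma sum_multinomial_le:
  fixes x :: "nat \<Rightarrow> real"
  assumes x: "\<And>i. x i \<ge> 0" and s: "\<And>F. finite F \<Longrightarrow> sum x F \<le> s" "s < 1" and S: "finite S"
  shows "(\<Sum>A\<in>S. fact (size A) / mi_fact A * (\<Prod>i\<in>#A. x i)) \<le> 1 / (1 - s)"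
proof -
  \<comment> \<open>The finite alphabet and the maximal length of the words that occur.\<close>
  define F where "F = (\<Union>A\<in>S. set_mset A)"
  define M where "M = Max (insert 0 (size ` S))"
  define L where "L m = {l. set l \<subseteq> F \<and> length l = m}" for m
  have F: "finite F" using S by (simp add: F_def)
  have finL: "finite (L m)" for m unfolding L_def by (rule finite_lists_length_eq[OF F])
  have s0: "s \<ge> 0" using s(1)[of "{}"] by simp
  have nn: "(\<Prod>i\<leftarrow>l. x i) \<ge> 0" for l by (induction l) (auto simp: x)
  have card_eq: "fact (size A) / mi_fact A * (\<Prod>i\<in>#A. x i)
      = (\<Sum>l\<in>permutations_of_multiset A. \<Prod>i\<leftarrow>l. x i)" for A
  proof -
    have *: "(\<Prod>i\<leftarrow>l. x i) = (\<Prod>i\<in>#A. x i)" if "l \<in> permutations_of_multiset A" for l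
      using that by (auto simp: permutations_of_multiset_def prod_mset_prod_list simp flip: mset_map)
    have "real (fact (size A)) = card (permutations_of_multiset A) * mi_fact A"
      using mi_fact_mult_card_permutations[of A] by (metis of_nat_mult)
    then show ?thesis by (simp add: *)
  qed
  have "(\<Sum>A\<in>S. fact (size A) / mi_fact A * (\<Prod>i\<in>#A. x i))
      = (\<Sum>A\<in>S. \<Sum>l\<in>permutations_of_multiset A. \<Prod>i\<leftarrow>l. x i)"
    by (simp only: card_eq)
  also have "\<dots> = (\<Sum>l\<in>(\<Union>A\<in>S. permutations_of_multiset A). \<Prod>i\<leftarrow>l. x i)"
    by (rule sum.UNION_disjoint[symmetric])
      (use S in \<open>auto dest: permutations_of_multisetD\<close>)
  also have "\<dots> \<le> (\<Sum>l\<in>(\<Union>m\<le>M. L m). \<Prod>i\<leftarrow>l. x i)"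
  proof (rule sum_mono2)
    show "(\<Union>A\<in>S. permutations_of_multiset A) \<subseteq> (\<Union>m\<le>M. L m)"
    proof
      fix l assume "l \<in> (\<Union>A\<in>S. permutations_of_multiset A)"
      then obtain A where A: "A \<in> S" "mset l = A" by (auto simp: permutations_of_multiset_def)
      have "length l \<le> M" unfolding M_def using A S by (intro Max_ge) (auto simp flip: size_mset)
      moreover have "set l \<subseteq> F" unfolding F_def using A by auto
      ultimately show "l \<in> (\<Union>m\<le>M. L m)" by (auto simp: L_def)
    qed
  qed (use finL nn in auto)
  also have "\<dots> = (\<Sum>m\<le>M. \<Sum>l\<in>L m. \<Prod>i\<leftarrow>l. x i)"
    by (rule sum.UNION_disjoint) (use finL in \<open>auto simp: L_def\<close>)
  also have "\<dots> = (\<Sum>m\<le>M. (sum x F) ^ m)"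
    unfolding L_def by (simp add: sum_prod_lists_length[OF F])
  also have "\<dots> \<le> (\<Sum>m\<le>M. s ^ m)"
    by (intro sum_mono power_mono s F sum_nonneg x)
  also have "\<dots> \<le> (\<Sum>m. s ^ m)"
    by (rule sum_le_suminf) (use s0 s in \<open>auto intro!: summable_geometric\<close>)
  also have "\<dots> = 1 / (1 - s)"
    using s0 s by (intro suminf_geometric) auto
  finally show ?thesis .
qed

text \<open>Dominated by the multinomial sum, since A! \<le> |A|!.\<close>

lemma sum_prod_mset_le:
  fixes x :: "nat \<Rightarrow> real"
  assumes x: "\<And>i. x i \<ge> 0" and s: "\<And>F. finite F \<Longrightarrow> sum x F \<le> s" "s < 1" and S: "finite S"
  shows "(\<Sum>A\<in>S. \<Prod>i\<in>#A. x i) \<le> 1 / (1 - s)"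
proof -
  have "(\<Prod>i\<in>#A. x i) \<le> fact (size A) / mi_fact A * (\<Prod>i\<in>#A. x i)" for A
  proof -
    have "(\<Prod>i\<in>#A. x i) \<ge> 0" by (induction A) (auto simp: x)
    moreover have "1 \<le> fact (size A) / real (mi_fact A)"
      using of_nat_mono[OF mi_fact_le[of A], where ?'a = real] mi_fact_pos[of A]
      by (simp add: le_divide_eq)
    ultimately show ?thesis using mult_right_mono[of 1 "fact (size A) / real (mi_fact A)" "\<Prod>i\<in>#A. x i"] by simp
  qed
  then have "(\<Sum>A\<in>S. \<Prod>i\<in>#A. x i) \<le> (\<Sum>A\<in>S. fact (size A) / mi_fact A * (\<Prod>i\<in>#A. x i))"
    by (rule sum_mono)
  also have "\<dots> \<le> 1 / (1 - s)" by (rule sum_multinomial_le[OF assms])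
  finally show ?thesis .
qed

section \<open>Taylor coefficients of separately entire functions\<close>

text \<open>First-order Taylor formula with remainder: Cauchy's inequality on unit circles about
  points within distance 1 of \<open>a\<close> bounds the second derivative by 2 B, hence the
  control of g up to distance 2. The estimate sees g only through B and is therefore uniform over
  families with a common bound.\<close>

lemma difference_quotient_bound:
  fixes g :: "complex \<Rightarrow> complex"
  assumes g: "g holomorphic_on UNIV" and B: "\<And>w. cmod (w - a) \<le> 2 \<Longrightarrow> cmod (g w) \<le> B"
    and h: "h \<noteq> 0" "cmod h \<le> 1"
  shows "cmod ((g (a + h) - g a) / h - deriv g a) \<le> 2 * B * cmod h"
proof -
  have hol: "(deriv ^^ i) g holomorphic_on UNIV" for i
    by (rule holomorphic_higher_deriv[OF g]) simp
  have B2: "cmod ((deriv ^^ 2) g x) \<le> 2 * B" if "x \<in> cball a 1" for x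
  proof -
    have "norm ((deriv ^^ 2) g x) \<le> fact 2 * B / 1 ^ 2"
    proof (rule Cauchy_inequality)
      show "continuous_on (cball x 1) g"
        using g holomorphic_on_imp_continuous_on continuous_on_subset by blast
      fix w assume "cmod (x - w) = 1"
      then have "cmod (w - a) \<le> 2"
        using that norm_triangle_ineq4[of "x - a" "x - w"] by (simp add: dist_norm norm_minus_commute)
      then show "cmod (g w) \<le> B" by (rule B)
    qed (use g holomorphic_on_subset in auto)
    then show ?thesis by (simp add: fact_2)
  qed
  have "cmod ((deriv ^^ 0) g (a + h) - (\<Sum>i\<le>1. (deriv ^^ i) g a * (a + h - a) ^ i / fact i))
      \<le> 2 * B * cmod (a + h - a) ^ Suc 1 / fact 1"
  proof (rule complex_Taylor)
    fix i :: nat and x assume "x \<in> cball a 1"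
    have "((deriv ^^ i) g has_field_derivative deriv ((deriv ^^ i) g) x) (at x)"
      using hol[of i] by (meson UNIV_I holomorphic_derivI open_UNIV)
    then show "((deriv ^^ i) g has_field_derivative (deriv ^^ Suc i) g x) (at x within cball a 1)"
      by (simp add: has_field_derivative_at_within)
  qed (use B2 h in \<open>auto simp: dist_norm numeral_2_eq_2\<close>)
  then have "cmod (g (a + h) - g a - deriv g a * h) \<le> 2 * B * cmod h * cmod h"
    by (simp add: power2_eq_square algebra_simps)
  moreover have "(g (a + h) - g a) / h - deriv g a = (g (a + h) - g a - deriv g a * h) / h"
    using h by (simp add: field_simps)
  ultimately show ?thesis
    using h by (simp add: norm_divide divide_le_eq)
qed

section \<open>Partial derivatives of separately entire functions\<close>

definition partial_deriv :: "nat \<Rightarrow> (hseq \<Rightarrow> complex) \<Rightarrow> hseq \<Rightarrow> complex" where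
  "partial_deriv v G x = deriv (\<lambda>z. G (x(v := z))) (x v)"

text \<open>Boundedness on finite-dimensional polydiscs is built in, so that Cauchy estimates apply
  at once and Hartogs' theorem is not invoked.\<close>

definition sep_entire :: "(hseq \<Rightarrow> complex) \<Rightarrow> bool" where
  "sep_entire G \<longleftrightarrow>
     (\<forall>x v. finite {i. x i \<noteq> 0} \<longrightarrow> (\<lambda>z. G (x(v := z))) holomorphic_on UNIV) \<and>
     (\<forall>M R. \<exists>B. \<forall>x. (\<forall>i\<ge>M. x i = 0) \<longrightarrow> (\<forall>i. cmod (x i) \<le> R) \<longrightarrow> cmod (G x) \<le> B)"

lemma sep_entireD:
  "sep_entire G \<Longrightarrow> finite {i. x i \<noteq> 0} \<Longrightarrow> (\<lambda>z. G (x(v := z))) holomorphic_on UNIV"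
  by (simp add: sep_entire_def)

lemma sep_entire_bound:
  assumes "sep_entire G"
  obtains B where "\<And>x. (\<And>i. i \<ge> M \<Longrightarrow> x i = 0) \<Longrightarrow> (\<And>i. cmod (x i) \<le> R) \<Longrightarrow> cmod (G x) \<le> B"
  using assms unfolding sep_entire_def by blast

lemma finite_support_upd: "finite {i. x i \<noteq> 0} \<Longrightarrow> finite {i. (x(v := z)) i \<noteq> (0::complex)}"
  by (rule finite_subset[of _ "insert v {i. x i \<noteq> 0}"]) auto

lemma finite_support_initial: "(\<And>i. i \<ge> M \<Longrightarrow> x i = 0) \<Longrightarrow> finite {i::nat. x i \<noteq> (0::complex)}"
  by (rule finite_subset[of _ "{..<M}"]) (auto simp: not_less[symmetric])

text \<open>For distinct variables the derivative in v is a locally uniform limit of difference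
  quotients, each of which is holomorphic in the other variable u.\<close>

lemma sep_entire_partial_deriv_holomorphic:
  assumes G: "sep_entire G" and x: "finite {i. x i \<noteq> 0}"
  shows "(\<lambda>z. partial_deriv v G (x(u := z))) holomorphic_on UNIV"
proof (cases "u = v")
  case True
  have "deriv (\<lambda>w. G (x(v := w))) holomorphic_on UNIV"
    by (intro holomorphic_deriv sep_entireD[OF G x]) auto
  then show ?thesis
    using True by (simp add: partial_deriv_def cong: holomorphic_cong)
next
  case False
  define h where "h z w = G (x(u := z, v := w))" for z w
  define a where "a = x v"
  define f where "f n z = (h z (a + 1 / of_nat (Suc n)) - h z a) * of_nat (Suc n)" for n z
  have hol1: "(\<lambda>w. h z w) holomorphic_on UNIV" for z
    unfolding h_def by (intro sep_entireD[OF G] finite_support_upd x)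
  have hol2: "(\<lambda>z. h z w) holomorphic_on UNIV" for w
  proof -
    have "(\<lambda>z. G ((x(v := w))(u := z))) holomorphic_on UNIV"
      by (intro sep_entireD[OF G] finite_support_upd x)
    then show ?thesis using False by (simp add: h_def fun_upd_twist)
  qed
  have eq: "partial_deriv v G (x(u := z)) = deriv (h z) a" for z
    using False by (simp add: partial_deriv_def h_def[abs_def] a_def)
  have "(\<lambda>z. deriv (h z) a) holomorphic_on UNIV"
  proof (rule holomorphic_uniform_sequence)
    show "f n holomorphic_on UNIV" for n
      unfolding f_def by (intro holomorphic_intros hol2)
    fix z0 :: complex
    obtain M where M: "{i. x i \<noteq> 0} \<union> {u, v} \<subseteq> {..<M}"
      using x by (metis finite_nat_iff_bounded finite_Un finite.emptyI finite.insertI)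
    \<comment> \<open>Large enough for the unit disc about z0 in variable u, the disc of radius 2
      about a in variable v, and all remaining coordinates of x.\<close>
    define R where "R = cmod z0 + cmod a + 2 + (\<Sum>i<M. cmod (x i))"
    obtain B where B: "\<And>y. (\<And>i. i \<ge> M \<Longrightarrow> y i = 0) \<Longrightarrow> (\<And>i. cmod (y i) \<le> R) \<Longrightarrow> cmod (G y) \<le> B"
      using sep_entire_bound[OF G] by metis
    have xR: "cmod (x i) \<le> (\<Sum>i<M. cmod (x i))" for i
    proof (cases "i < M")
      case True
      then show ?thesis by (intro member_le_sum) auto
    next
      case False
      then have "x i = 0" using M by auto
      then show ?thesis by (simp add: sum_nonneg)
    qed
    have sum0: "0 \<le> (\<Sum>i<M. cmod (x i))" by (simp add: sum_nonneg)
    have hB: "cmod (h z w) \<le> B" if "cmod (w - a) \<le> 2" "z \<in> cball z0 1" for z w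
      unfolding h_def
    proof (rule B)
      show "(x(u := z, v := w)) i = 0" if "i \<ge> M" for i
        using that M by auto
      have "cmod z \<le> cmod z0 + 1"
        using that(2) norm_triangle_ineq2[of z z0] by (simp add: dist_norm norm_minus_commute)
      moreover have "cmod w \<le> cmod a + 2"
        using that(1) norm_triangle_ineq2[of w a] by simp
      ultimately have "cmod z \<le> R" "cmod w \<le> R" "cmod (x i) \<le> R" for i
        using xR[of i] sum0 norm_ge_zero[of a] norm_ge_zero[of z0] unfolding R_def by linarith+
      then show "cmod ((x(u := z, v := w)) i) \<le> R" for i by simp
    qed
    have "uniform_limit (cball z0 1) f (\<lambda>z. deriv (h z) a) sequentially"
    proof (rule uniform_limitI)
      fix e :: real assume e: "e > 0"
      have B0: "B \<ge> 0" using hB[of a z0] norm_ge_zero[of "h z0 a"] by (simp del: norm_ge_zero)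
      obtain N where N: "2 * B / e < real N" using reals_Archimedean2 by blast
      have "dist (f n z) (deriv (h z) a) < e" if n: "n \<ge> N" and z: "z \<in> cball z0 1" for n z
      proof -
        let ?h = "1 / of_nat (Suc n) :: complex"
        have nh: "cmod ?h = 1 / real (Suc n)" by (simp add: norm_divide del: of_nat_Suc)
        have "cmod ((h z (a + ?h) - h z a) / ?h - deriv (h z) a) \<le> 2 * B * cmod ?h"
          by (rule difference_quotient_bound[OF hol1])
            (use hB z in \<open>auto simp: norm_divide simp del: of_nat_Suc\<close>)
        also have "\<dots> = 2 * B / real (Suc n)" using nh by simp
        also have "\<dots> < e"
        proof -
          have "2 * B / e < real (Suc n)" using N n by linarith
          then show ?thesis using e by (simp add: field_simps)
        qed
        finally show ?thesis by (simp add: f_def dist_norm)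
      qed
      then show "\<forall>\<^sub>F n in sequentially. \<forall>z\<in>cball z0 1. dist (f n z) (deriv (h z) a) < e"
        unfolding eventually_sequentially by blast
    qed
    then show "\<exists>d>0. cball z0 d \<subseteq> UNIV \<and> uniform_limit (cball z0 d) f (\<lambda>z. deriv (h z) a) sequentially"
      by (intro exI[of _ 1]) auto
  qed auto
  then show ?thesis by (simp add: eq)
qed

lemma sep_entire_partial_deriv:
  assumes G: "sep_entire G"
  shows "sep_entire (partial_deriv v G)"
proof -
  have "\<exists>B. \<forall>x. (\<forall>i\<ge>M. x i = 0) \<longrightarrow> (\<forall>i. cmod (x i) \<le> R) \<longrightarrow> cmod (partial_deriv v G x) \<le> B" for M R
  proof -
    \<comment> \<open>Cauchy's inequality uses the unit circle about x v. It moves coordinate v,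
      which may lie beyond the first M, and enlarges the radius by 1.\<close>
    obtain B where B: "\<And>x. (\<And>i. i \<ge> max M (Suc v) \<Longrightarrow> x i = 0) \<Longrightarrow> (\<And>i. cmod (x i) \<le> R + 1) \<Longrightarrow> cmod (G x) \<le> B"
      using sep_entire_bound[OF G] by metis
    have "cmod (partial_deriv v G x) \<le> B" if x: "\<forall>i\<ge>M. x i = 0" "\<forall>i. cmod (x i) \<le> R" for x
    proof -
      have hol: "(\<lambda>z. G (x(v := z))) holomorphic_on UNIV"
        using x(1) by (intro sep_entireD[OF G] finite_support_initial) auto
      have "norm ((deriv ^^ 1) (\<lambda>z. G (x(v := z))) (x v)) \<le> fact 1 * B / 1 ^ 1"
      proof (rule Cauchy_inequality)
        show "continuous_on (cball (x v) 1) (\<lambda>z. G (x(v := z)))"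
          using hol holomorphic_on_imp_continuous_on continuous_on_subset by blast
        fix w assume "cmod (x v - w) = 1"
        then have "cmod w \<le> R + 1"
          using x(2)[rule_format, of v] norm_triangle_ineq2[of w "x v"] by (simp add: norm_minus_commute)
        then show "cmod (G (x(v := w))) \<le> B"
          using x by (intro B) (auto simp: add_increasing2)
      qed (use hol holomorphic_on_subset in auto)
      then show ?thesis by (simp add: partial_deriv_def)
    qed
    then show ?thesis by blast
  qed
  then show ?thesis
    unfolding sep_entire_def using sep_entire_partial_deriv_holomorphic[OF G] by blast
qed

lemma sep_entire_funpow: "sep_entire G \<Longrightarrow> sep_entire ((partial_deriv v ^^ m) G)"
  by (induction m) (auto simp: sep_entire_partial_deriv)

lemma funpow_partial_deriv:
  "(partial_deriv v ^^ m) G x = (deriv ^^ m) (\<lambda>z. G (x(v := z))) (x v)"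
proof (induction m arbitrary: x)
  case (Suc m)
  have "(\<lambda>z. (partial_deriv v ^^ m) G (x(v := z))) = (deriv ^^ m) (\<lambda>z. G (x(v := z)))"
    by (rule ext) (simp only: Suc.IH fun_upd_upd fun_upd_same)
  then show ?case
    by (simp only: funpow.simps o_apply partial_deriv_def[of v "(partial_deriv v ^^ m) G"])
qed simp

text \<open>Sorting fixes the order of differentiation, so partial derivatives never have to be
  interchanged. \<open>foldr\<close> applies the largest index first, which suits inductions that
  split off the last variable.\<close>

definition taylor_coef :: "(hseq \<Rightarrow> complex) \<Rightarrow> nat multiset \<Rightarrow> complex" where
  "taylor_coef G A = foldr partial_deriv (sorted_list_of_multiset A) G (\<lambda>_. 0) / of_nat (mi_fact A)"

lemma taylor_coef_empty [simp]: "taylor_coef G {#} = G (\<lambda>_. 0)"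
  by (simp add: taylor_coef_def)

lemma taylor_coef_add_replicate:
  assumes "set_mset A \<subseteq> {..<M}"
  shows "taylor_coef G (A + replicate_mset m M) = taylor_coef ((partial_deriv M ^^ m) G) A / fact m"
proof -
  let ?xs = "sorted_list_of_multiset A @ replicate m M"
  have "sorted ?xs" using assms by (auto simp: sorted_append)
  then have "sorted_list_of_multiset (mset ?xs) = ?xs"
    by (simp only: sorted_list_of_multiset_mset sorted_sort_id)
  then have *: "sorted_list_of_multiset (A + replicate_mset m M) = ?xs" by simp
  have fr: "foldr f (replicate m M) = f M ^^ m" for f :: "nat \<Rightarrow> (hseq \<Rightarrow> complex) \<Rightarrow> _"
    by (induction m) auto
  have "set_mset A \<inter> set_mset (replicate_mset m M) = {}" using assms by auto
  from mi_fact_add_disjoint[OF this] show ?thesis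
    by (simp add: taylor_coef_def * fr)
qed

lemma multiset_split_last:
  assumes "set_mset A \<subseteq> {..<Suc M}"
  obtains D m where "set_mset D \<subseteq> {..<M}" "A = D + replicate_mset m M"
proof
  show "set_mset {#i \<in># A. i \<noteq> M#} \<subseteq> {..<M}" using assms by auto
  show "A = {#i \<in># A. i \<noteq> M#} + replicate_mset (count A M) M"
    by (rule multiset_eqI) simp
qed

text \<open>Cauchy's inequality in the last variable bounds its m-th derivative by m! B / r^m on the
  smaller polydisc, and the induction hypothesis applies to that derivative. Radii may vanish at
  indices outside A, as the optimal radii chosen later do.\<close>

lemma taylor_coef_Cauchy_bound:
  assumes "sep_entire G" "set_mset A \<subseteq> {..<M}" "\<And>v. r v \<ge> 0" "\<And>v. v \<in># A \<Longrightarrow> r v > 0"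
    and "\<And>x. (\<And>v. v \<ge> M \<Longrightarrow> x v = 0) \<Longrightarrow> (\<And>v. v < M \<Longrightarrow> cmod (x v) \<le> r v) \<Longrightarrow> cmod (G x) \<le> B"
  shows "cmod (taylor_coef G A) * (\<Prod>v\<in>#A. r v) \<le> B"
  using assms
proof (induction M arbitrary: G A B)
  case 0
  then show ?case by simp
next
  case (Suc M)
  obtain D m where D: "set_mset D \<subseteq> {..<M}" and A: "A = D + replicate_mset m M"
    using multiset_split_last Suc.prems(2) by blast
  have rM: "r M > 0" if "m > 0" using Suc.prems(4)[of M] that A by auto
  have rm: "r M ^ m > 0" using rM by (cases "m = 0") auto
  define G' where "G' = (partial_deriv M ^^ m) G"
  have "cmod (taylor_coef G' D) * (\<Prod>v\<in>#D. r v) \<le> fact m * B / r M ^ m"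
  proof (rule Suc.IH[OF _ D Suc.prems(3)])
    show "sep_entire G'" unfolding G'_def by (rule sep_entire_funpow) fact
    show "r v > 0" if "v \<in># D" for v using Suc.prems(4) that A by simp
    fix x :: hseq assume x: "\<And>v. v \<ge> M \<Longrightarrow> x v = 0" "\<And>v. v < M \<Longrightarrow> cmod (x v) \<le> r v"
    show "cmod (G' x) \<le> fact m * B / r M ^ m"
    \<comment> \<open>For m = 0 the radius \<open>r M\<close> may be 0 and there is no circle; the
      point x itself, with coordinate M equal to 0, is admissible.\<close>
    proof (cases "m = 0")
      case True
      have "cmod (G x) \<le> B"
        using x Suc.prems(3) by (intro Suc.prems(5)) (auto simp: less_Suc_eq)
      then show ?thesis using True by (simp add: G'_def)
    next
      case False
      have hol: "(\<lambda>z. G (x(M := z))) holomorphic_on UNIV"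
        using x(1) by (intro sep_entireD[OF Suc.prems(1)] finite_support_initial) auto
      have "cmod ((deriv ^^ m) (\<lambda>z. G (x(M := z))) 0) \<le> fact m * B / r M ^ m"
      proof (rule Cauchy_inequality)
        show "continuous_on (cball 0 (r M)) (\<lambda>z. G (x(M := z)))"
          using hol holomorphic_on_imp_continuous_on continuous_on_subset by blast
        fix w :: complex assume "cmod (0 - w) = r M"
        then show "cmod (G (x(M := w))) \<le> B"
          using x by (intro Suc.prems(5)) auto
      qed (use hol holomorphic_on_subset False rM in auto)
      then show ?thesis using x(1)[of M] by (simp add: G'_def funpow_partial_deriv)
    qed
  qed
  then show ?case
    using rm by (simp add: A taylor_coef_add_replicate[OF D] norm_divide G'_def field_simps)
qed

section \<open>Power series expansion in finitely many variables\<close>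

definition truncate :: "nat \<Rightarrow> hseq \<Rightarrow> hseq" where
  "truncate M x = (\<lambda>v. if v < M then x v else 0)"

lemma truncate_Suc: "truncate (Suc M) x = (truncate M x)(M := x M)"
  by (auto simp: truncate_def less_Suc_eq)

lemma norm_prod_mset: "norm (\<Prod>v\<in>#A. f v :: complex) = (\<Prod>v\<in>#A. norm (f v))"
  by (induction A) (auto simp: norm_mult)

lemma prod_mset_nonneg: "(\<And>v. f v \<ge> 0) \<Longrightarrow> (\<Prod>v\<in>#A. f v) \<ge> (0::real)"
  by (induction A) auto

lemma prod_mset_mono:
  "(\<And>v. v \<in># A \<Longrightarrow> 0 \<le> f v) \<Longrightarrow> (\<And>v. v \<in># A \<Longrightarrow> f v \<le> g v) \<Longrightarrow> (\<Prod>v\<in>#A. f v) \<le> (\<Prod>v\<in>#A. g v :: real)"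
proof (induction A)
  case (add v A)
  have "0 \<le> (\<Prod>v\<in>#B. f v)" if "set_mset B \<subseteq> set_mset A" for B
    using that add.prems(1) by (induction B) auto
  then have "0 \<le> (\<Prod>v\<in>#A. f v)" by blast
  moreover have "0 \<le> g v" using add.prems[of v] by (meson order_trans union_single_eq_member)
  ultimately show ?case using add by (auto intro!: mult_mono)
qed simp

text \<open>Cauchy's estimate at radii r with |x_v| \<le> r_v q_v bounds the terms by B q^A, whose
  sum is finite once the q_v add up to at most 1/2.\<close>

lemma taylor_abs_summable_finite:
  assumes G: "sep_entire G"
  shows "(\<lambda>A. norm (taylor_coef G A * (\<Prod>v\<in>#A. x v))) summable_on {A. set_mset A \<subseteq> {..<M}}"
proof -
  \<comment> \<open>The M values of q add up to M / (2 (M + 1)). The summand 1 in r keeps the radii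
    positive where x vanishes.\<close>
  define q where "q v = (if v < M then 1 / (2 * (real M + 1)) else 0)" for v
  define r where "r v = (if v < M then (cmod (x v) + 1) / q v else 0)" for v
  have q0: "q v \<ge> 0" for v by (simp add: q_def)
  have qp: "q v > 0" if "v < M" for v using that by (simp add: q_def)
  have r0: "r v \<ge> 0" for v using q0 by (auto simp: r_def)
  have rp: "r v > 0" if "v < M" for v
    using that qp[OF that] by (simp add: r_def add_nonneg_pos)
  have rR: "r v \<le> (\<Sum>v<M. r v)" if "v < M" for v
    using that r0 by (intro member_le_sum) auto
  obtain B where B: "\<And>y. (\<And>i. i \<ge> M \<Longrightarrow> y i = 0) \<Longrightarrow> (\<And>i. cmod (y i) \<le> (\<Sum>v<M. r v)) \<Longrightarrow> cmod (G y) \<le> B"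
    using sep_entire_bound[OF G] by metis
  have B0: "B \<ge> 0"
    using B[of "\<lambda>_. 0"] norm_ge_zero[of "G (\<lambda>_. 0)"] r0 by (simp add: sum_nonneg del: norm_ge_zero)
  have bd: "norm (taylor_coef G A * (\<Prod>v\<in>#A. x v)) \<le> B * (\<Prod>v\<in>#A. q v)" if A: "set_mset A \<subseteq> {..<M}" for A
  proof -
    have "cmod (taylor_coef G A) * (\<Prod>v\<in>#A. r v) \<le> B"
    proof (rule taylor_coef_Cauchy_bound[OF G A r0])
      show "r v > 0" if "v \<in># A" for v using rp A that by auto
      fix y :: hseq assume y: "\<And>v. v \<ge> M \<Longrightarrow> y v = 0" "\<And>v. v < M \<Longrightarrow> cmod (y v) \<le> r v"
      have "cmod (y i) \<le> (\<Sum>v<M. r v)" for i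
        using y rR[of i] r0 by (cases "i < M") (auto simp: sum_nonneg intro: order_trans)
      then show "cmod (G y) \<le> B" using y by (intro B) auto
    qed
    moreover have "(\<Prod>v\<in>#A. cmod (x v)) \<le> (\<Prod>v\<in>#A. r v * q v)"
    proof (rule prod_mset_mono)
      fix v assume "v \<in># A"
      then have "v < M" using A by auto
      then show "cmod (x v) \<le> r v * q v" using qp[of v] by (simp add: r_def)
    qed simp
    moreover have "(\<Prod>v\<in>#A. q v) \<ge> 0" by (intro prod_mset_nonneg q0)
    ultimately have "cmod (taylor_coef G A) * (\<Prod>v\<in>#A. cmod (x v)) \<le> B * (\<Prod>v\<in>#A. q v)"
    proof -
      assume a: "cmod (taylor_coef G A) * (\<Prod>v\<in>#A. r v) \<le> B"
        and b: "(\<Prod>v\<in>#A. cmod (x v)) \<le> (\<Prod>v\<in>#A. r v * q v)" and c: "(\<Prod>v\<in>#A. q v) \<ge> 0"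
      have "cmod (taylor_coef G A) * (\<Prod>v\<in>#A. cmod (x v))
          \<le> cmod (taylor_coef G A) * (\<Prod>v\<in>#A. r v) * (\<Prod>v\<in>#A. q v)"
        using mult_left_mono[OF b, of "cmod (taylor_coef G A)"]
        by (simp add: prod_mset.distrib mult_ac)
      also have "\<dots> \<le> B * (\<Prod>v\<in>#A. q v)" using a c by (rule mult_right_mono)
      finally show ?thesis .
    qed
    then show ?thesis by (simp add: norm_mult norm_prod_mset)
  qed
  show ?thesis
  proof (rule nonneg_bounded_partial_sums_imp_summable_on)
    show "\<forall>\<^sub>F S in finite_subsets_at_top {A. set_mset A \<subseteq> {..<M}}.
        (\<Sum>A\<in>S. norm (taylor_coef G A * (\<Prod>v\<in>#A. x v))) \<le> B * 2"
    proof (rule eventually_finite_subsets_at_top_weakI)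
      fix S :: "nat multiset set" assume S: "finite S" "S \<subseteq> {A. set_mset A \<subseteq> {..<M}}"
      have "(\<Sum>A\<in>S. norm (taylor_coef G A * (\<Prod>v\<in>#A. x v))) \<le> (\<Sum>A\<in>S. B * (\<Prod>v\<in>#A. q v))"
        using S bd by (intro sum_mono) blast
      also have "\<dots> = B * (\<Sum>A\<in>S. \<Prod>v\<in>#A. q v)" by (simp add: sum_distrib_left)
      also have "(\<Sum>A\<in>S. \<Prod>v\<in>#A. q v) \<le> 1 / (1 - 1/2)"
      proof (rule sum_prod_mset_le[OF q0 _ _ S(1)])
        fix F :: "nat set" assume "finite F"
        then have "sum q F \<le> sum q (F \<union> {..<M})" by (intro sum_mono2 q0) auto
        also have "\<dots> = sum q {..<M}"
          using \<open>finite F\<close> by (intro sum.mono_neutral_right) (auto simp: q_def)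
        also have "\<dots> \<le> 1/2" by (simp add: q_def field_simps)
        finally show "sum q F \<le> 1/2" .
      qed simp
      then have "B * (\<Sum>A\<in>S. \<Prod>v\<in>#A. q v) \<le> B * 2" using B0 by (intro mult_left_mono) auto
      finally show "(\<Sum>A\<in>S. norm (taylor_coef G A * (\<Prod>v\<in>#A. x v))) \<le> B * 2" .
    qed
  qed simp
qed

text \<open>Multi-indices in M + 1 variables are pairs of a power of the last variable and a
  multi-index in the first M. Absolute summability allows summing over the latter first; this gives
  the last-variable derivatives by the induction hypothesis, and the one-variable Taylor series sums
  those.\<close>

lemma taylor_expansion_finite:
  assumes "sep_entire G"
  shows "((\<lambda>A. taylor_coef G A * (\<Prod>v\<in>#A. x v)) has_sum G (truncate M x)) {A. set_mset A \<subseteq> {..<M}}"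
  using assms
proof (induction M arbitrary: G)
  case 0
  have "{A :: nat multiset. set_mset A \<subseteq> {..<0}} = {{#}}" by auto
  then show ?case using has_sum_finite[of "{{#}}" "\<lambda>A. taylor_coef G A * (\<Prod>v\<in>#A. x v)"]
    by (simp add: truncate_def)
next
  case (Suc M)
  let ?f = "\<lambda>A. taylor_coef G A * (\<Prod>v\<in>#A. x v)"
  let ?N = "\<lambda>M. {A. set_mset A \<subseteq> {..<M}}"
  define j where "j = (\<lambda>(m, D). D + replicate_mset m M)"
  have cnt: "count (j (m, D)) i = (if i = M then m else count D i)" if "D \<in> ?N M" for m D i
    using that by (auto simp: j_def not_in_iff[symmetric])
  have bij: "bij_betw j (UNIV \<times> ?N M) (?N (Suc M))"
  proof (rule bij_betwI')
    fix p q :: "nat \<times> nat multiset" assume pq: "p \<in> UNIV \<times> ?N M" "q \<in> UNIV \<times> ?N M"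
    obtain m D where p: "p = (m, D)" by force
    obtain n E where q: "q = (n, E)" by force
    show "j p = j q \<longleftrightarrow> p = q"
    proof
      assume eq: "j p = j q"
      have D: "D \<in> ?N M" and E: "E \<in> ?N M" using pq p q by auto
      have c: "(if i = M then m else count D i) = (if i = M then n else count E i)" for i
        using cnt[OF D, of m i] cnt[OF E, of n i] eq p q by simp
      have "count D M = 0" "count E M = 0" using D E by (auto simp flip: not_in_iff)
      then have "count D i = count E i" for i using c[of i] by (cases "i = M") auto
      then have "D = E" by (rule multiset_eqI)
      then show "p = q" using c[of M] p q by simp
    qed simp
  next
    fix p :: "nat \<times> nat multiset" assume "p \<in> UNIV \<times> ?N M"
    then show "j p \<in> ?N (Suc M)" by (force simp: j_def split: if_splits)
  next
    fix A assume "A \<in> ?N (Suc M)"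
    then obtain D m where "set_mset D \<subseteq> {..<M}" "A = D + replicate_mset m M"
      using multiset_split_last by blast
    then show "\<exists>p\<in>UNIV \<times> ?N M. A = j p" by (intro bexI[of _ "(m, D)"]) (auto simp: j_def)
  qed
  have "?f summable_on ?N (Suc M)"
    using taylor_abs_summable_finite[OF Suc.prems] by (rule abs_summable_summable)
  then obtain S where S: "(?f has_sum S) (?N (Suc M))" by (auto simp: summable_on_def)
  then have S': "((\<lambda>p. ?f (j p)) has_sum S) (UNIV \<times> ?N M)"
    by (rule has_sum_reindex_bij_betw[OF bij, of ?f S, THEN iffD2])
  let ?G = "\<lambda>m. (partial_deriv M ^^ m) G"
  \<comment> \<open>The inner sums are expansions of the m-th derivative in variable M, taken at a
    point whose coordinate M is 0.\<close>
  have "((\<lambda>m. ?G m (truncate M x) * (x M ^ m / fact m)) has_sum S) UNIV"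
  proof (rule has_sum_SigmaD[OF S'])
    fix m :: nat
    have "((\<lambda>D. taylor_coef (?G m) D * (\<Prod>v\<in>#D. x v) * (x M ^ m / fact m)) has_sum
        ?G m (truncate M x) * (x M ^ m / fact m)) (?N M)"
      by (intro has_sum_cmult_left Suc.IH sep_entire_funpow Suc.prems)
    then show "((\<lambda>D. ?f (j (m, D))) has_sum ?G m (truncate M x) * (x M ^ m / fact m)) (?N M)"
      by (rule has_sum_cong[THEN iffD1, rotated])
        (simp add: j_def taylor_coef_add_replicate)
  qed
  then have "(\<lambda>m. ?G m (truncate M x) * (x M ^ m / fact m)) sums S"
    by (rule has_sum_imp_sums)
  moreover have "(\<lambda>m. ?G m (truncate M x) * (x M ^ m / fact m)) sums G (truncate (Suc M) x)"
  proof -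
    have "(\<lambda>z. G ((truncate M x)(M := z))) holomorphic_on UNIV"
      by (intro sep_entireD[OF Suc.prems] finite_support_initial[of M]) (simp add: truncate_def)
    then have "(\<lambda>m. (deriv ^^ m) (\<lambda>z. G ((truncate M x)(M := z))) 0 / fact m * (x M - 0) ^ m)
        sums G ((truncate M x)(M := x M))"
      by (intro holomorphic_power_series[where r = "cmod (x M) + 1"])
        (auto intro: holomorphic_on_subset)
    then show ?thesis
      by (simp add: funpow_partial_deriv truncate_Suc truncate_def[of M x] mult_ac)
  qed
  ultimately show ?case using S sums_unique2 by blast
qed

section \<open>Entire functions with a Gaussian bound\<close>

text \<open>Schwarz lemma for w \<mapsto> (g(R w) - g(0)) / (2 B + 1), evaluated at w = 1/R. The
  added 1 makes the values strictly less than 1 in modulus and the denominator nonzero when B =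
  0.\<close>

lemma entire_increment_bound:
  fixes g :: "complex \<Rightarrow> complex"
  assumes g: "g holomorphic_on UNIV" and R: "R > 1" and B: "\<And>z. cmod z \<le> R \<Longrightarrow> cmod (g z) \<le> B"
  shows "cmod (g 1 - g 0) \<le> (2 * B + 1) / R"
proof -
  define f where "f w = (g (of_real R * w) - g 0) / of_real (2 * B + 1)" for w
  have B0: "B \<ge> 0" by (rule order_trans[OF norm_ge_zero B[of 0]]) (use R in simp)
  have cB: "cmod (of_real (2 * B + 1)) = 2 * B + 1" by (subst norm_of_real) (use B0 in simp)
  have hol: "f holomorphic_on ball 0 1"
    unfolding f_def
    using B0 by (intro holomorphic_intros holomorphic_on_compose_gen[OF _ g, unfolded o_def]) auto
  have "cmod (f (of_real (1 / R))) \<le> cmod (of_real (1 / R))"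
  proof (rule Schwarz_Lemma(1)[OF hol])
    fix z :: complex assume z: "cmod z < 1"
    have "cmod (g (of_real R * z) - g 0) \<le> cmod (g (of_real R * z)) + cmod (g 0)"
      by (rule norm_triangle_ineq4)
    also have "\<dots> \<le> B + B"
      using z R by (intro add_mono B) (auto simp: norm_mult)
    finally show "cmod (f z) < 1"
      using B0 unfolding f_def norm_divide cB by simp
  qed (use R in \<open>auto simp: f_def norm_divide\<close>)
  moreover have "f (of_real (1 / R)) = (g 1 - g 0) / of_real (2 * B + 1)"
    using R by (simp add: f_def)
  ultimately have "cmod (g 1 - g 0) / (2 * B + 1) \<le> 1 / R"
    using R B0 by (simp only: norm_divide cB norm_of_real) simp
  then show ?thesis using B0 R by (simp add: field_simps)
qed

lemma has_sum_exhaustion: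
  fixes f :: "'a \<Rightarrow> 'b::real_normed_vector"
  assumes L: "(f has_sum L) UNIV" and l: "\<And>M. (f has_sum l M) (N M)"
    and N: "\<And>S. finite S \<Longrightarrow> \<exists>M0. \<forall>M\<ge>M0. S \<subseteq> N (M::nat)"
  shows "l \<longlonglongrightarrow> L"
proof (rule metric_LIMSEQ_I)
  fix e :: real assume e: "e > 0"
  have "\<forall>\<^sub>F T in finite_subsets_at_top UNIV. dist (sum f T) L < e / 2"
    using L e unfolding has_sum_def by (intro tendstoD) auto
  then obtain S0 where S0: "finite S0" "\<And>T. finite T \<Longrightarrow> S0 \<subseteq> T \<Longrightarrow> dist (sum f T) L < e / 2"
    unfolding eventually_finite_subsets_at_top by auto
  obtain M0 where M0: "\<forall>M\<ge>M0. S0 \<subseteq> N M" using N[OF S0(1)] by blast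
  have "dist (l M) L < e" if M: "M \<ge> M0" for M
  proof -
    have "\<forall>\<^sub>F T in finite_subsets_at_top (N M). dist (sum f T) (l M) < e / 2"
      using l[of M] e unfolding has_sum_def by (intro tendstoD) auto
    then obtain S1 where S1: "finite S1" "S1 \<subseteq> N M"
        "\<And>T. finite T \<Longrightarrow> S1 \<subseteq> T \<Longrightarrow> T \<subseteq> N M \<Longrightarrow> dist (sum f T) (l M) < e / 2"
      unfolding eventually_finite_subsets_at_top by auto
    \<comment> \<open>One finite set serves both limits: it contains S0, which controls the distance
      to L, and it lies in N M and contains S1, which controls the distance to l M.\<close>
    have "dist (sum f (S0 \<union> S1)) L < e / 2" using S0 S1 by auto
    moreover have "dist (sum f (S0 \<union> S1)) (l M) < e / 2" using S0 S1 M0 M by auto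
    ultimately show ?thesis by (metis dist_commute dist_triangle_half_l)
  qed
  then show "\<exists>M0. \<forall>M\<ge>M0. dist (l M) L < e" by blast
qed

text \<open>The slots are forgotten here: what remains of \<open>O2\<close> is one diagonal
  quadratic form with weights c, and of \<open>O1\<close> holomorphy along complex lines in X.
  Closure under tails is required because the tail of x is the direction of the line that joins a
  truncation to x.\<close>

locale gaussian_entire =
  fixes G :: "hseq \<Rightarrow> complex" and X :: "hseq set" and c :: "nat \<Rightarrow> real" and C :: real
  assumes finite_support: "finite {v. x v \<noteq> 0} \<Longrightarrow> x \<in> X"
    and tail: "x \<in> X \<Longrightarrow> (\<lambda>v. x v - truncate M x v) \<in> X"
    and line: "x \<in> X \<Longrightarrow> y \<in> X \<Longrightarrow> (\<lambda>z. G (\<lambda>v. z * y v + x v)) holomorphic_on UNIV"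
    and line_mem: "x \<in> X \<Longrightarrow> y \<in> X \<Longrightarrow> (\<lambda>v. z * y v + x v) \<in> X"
    and weight_pos: "c v > 0"
    and weight_summable: "x \<in> X \<Longrightarrow> (\<lambda>v. c v * (cmod (x v))\<^sup>2) summable_on UNIV"
    and bound: "x \<in> X \<Longrightarrow> (cmod (G x))\<^sup>2 \<le> C * exp (\<Sum>\<^sub>\<infinity>v. c v * (cmod (x v))\<^sup>2)"
begin

lemma truncate_mem: "truncate M x \<in> X"
  by (intro finite_support finite_support_initial[of M]) (simp add: truncate_def)

lemma C_nonneg: "C \<ge> 0"
proof -
  have "0 \<le> (cmod (G (\<lambda>_. 0)))\<^sup>2" by simp
  also have "\<dots> \<le> C * exp (\<Sum>\<^sub>\<infinity>v. c v * (cmod 0)\<^sup>2)" by (intro bound finite_support) simp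
  finally show ?thesis by simp
qed

lemma bound_initial:
  assumes "\<And>v. v \<ge> M \<Longrightarrow> x v = 0"
  shows "(cmod (G x))\<^sup>2 \<le> C * exp (\<Sum>v<M. c v * (cmod (x v))\<^sup>2)"
proof -
  have "(\<Sum>\<^sub>\<infinity>v. c v * (cmod (x v))\<^sup>2) = (\<Sum>\<^sub>\<infinity>v\<in>{..<M}. c v * (cmod (x v))\<^sup>2)"
    using assms by (intro infsum_cong_neutral) (auto simp: not_less)
  then show ?thesis
    using bound[OF finite_support[OF finite_support_initial[of M x]]] assms by simp
qed

lemma sep_entire: "sep_entire G"
  unfolding sep_entire_def
proof (intro conjI allI impI)
  fix x :: hseq and v assume x: "finite {i. x i \<noteq> 0}"
  have "(\<lambda>z. G (\<lambda>i. z * ((\<lambda>_. 0)(v := 1)) i + (x(v := 0)) i)) holomorphic_on UNIV"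
    by (intro line finite_support finite_support_upd x) simp
  moreover have "(\<lambda>i. z * ((\<lambda>_. 0)(v := 1)) i + (x(v := 0)) i) = x(v := z)" for z
    by auto
  ultimately show "(\<lambda>z. G (x(v := z))) holomorphic_on UNIV" by simp
next
  fix M :: nat and R :: real
  have "cmod (G x) \<le> sqrt (C * exp (\<Sum>v<M. c v * R\<^sup>2))"
    if x: "\<forall>i\<ge>M. x i = 0" "\<forall>i. cmod (x i) \<le> R" for x
  proof (rule real_le_rsqrt)
    have "(cmod (G x))\<^sup>2 \<le> C * exp (\<Sum>v<M. c v * (cmod (x v))\<^sup>2)"
      using x by (intro bound_initial) auto
    also have "\<dots> \<le> C * exp (\<Sum>v<M. c v * R\<^sup>2)"
      using x C_nonneg weight_pos
      by (intro mult_left_mono exp_le_cancel_iff[THEN iffD2] sum_mono power_mono) (auto simp: less_imp_le)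
    finally show "(cmod (G x))\<^sup>2 \<le> C * exp (\<Sum>v<M. c v * R\<^sup>2)" .
  qed
  then show "\<exists>B. \<forall>x. (\<forall>i\<ge>M. x i = 0) \<longrightarrow> (\<forall>i. cmod (x i) \<le> R) \<longrightarrow> cmod (G x) \<le> B" by blast
qed

text \<open>
  The Cauchy estimate is optimised at the radii \<open>r\<^sub>v\<^sup>2 = \<alpha>\<^sub>v / c\<^sub>v\<close>, where \<open>\<alpha>\<^sub>v\<close> is the multiplicity
  of \<open>v\<close> in \<open>A\<close>; then \<open>n! \<le> n\<^sup>n\<close>.
\<close>

lemma taylor_coef_bound:
  "(cmod (taylor_coef G A))\<^sup>2 \<le> C * (\<Prod>v\<in>#A. exp 1 * c v) / mi_fact A"
proof -
  obtain M where M: "set_mset A \<subseteq> {..<M}" using finite_nat_iff_bounded by blast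
  define r where "r v = sqrt (count A v / c v)" for v
  have r2: "(r v)\<^sup>2 = count A v / c v" for v using weight_pos[of v] by (simp add: r_def less_imp_le)
  \<comment> \<open>At these radii the Gaussian exponent adds up to |A|; the resulting exp |A| is
    the factor e per letter of A in the bound.\<close>
  have sz: "(\<Sum>v<M. real (count A v)) = size A"
  proof -
    have "(\<Sum>v<M. real (count A v)) = (\<Sum>v\<in>set_mset A. real (count A v))"
      by (rule sum.mono_neutral_right) (use M in \<open>auto simp: not_in_iff\<close>)
    then show ?thesis by (simp add: size_multiset_overloaded_eq)
  qed
  have "cmod (taylor_coef G A) * (\<Prod>v\<in>#A. r v) \<le> sqrt (C * exp (size A))"
  proof (rule taylor_coef_Cauchy_bound[OF sep_entire M])
    show "r v \<ge> 0" for v using weight_pos[of v] by (simp add: r_def less_imp_le)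
    show "r v > 0" if "v \<in># A" for v using weight_pos[of v] that by (simp add: r_def)
    fix x :: hseq assume x: "\<And>v. v \<ge> M \<Longrightarrow> x v = 0" "\<And>v. v < M \<Longrightarrow> cmod (x v) \<le> r v"
    have "(\<Sum>v<M. c v * (cmod (x v))\<^sup>2) \<le> (\<Sum>v<M. c v * (r v)\<^sup>2)"
      using x weight_pos by (intro sum_mono mult_left_mono power_mono) (auto simp: less_imp_le)
    also have "\<dots> = (\<Sum>v<M. real (count A v))"
      using weight_pos by (intro sum.cong) (auto simp: r2 less_imp_neq[symmetric])
    finally have "C * exp (\<Sum>v<M. c v * (cmod (x v))\<^sup>2) \<le> C * exp (size A)"
      using C_nonneg sz by (intro mult_left_mono) auto
    with bound_initial[of M x] x(1) show "cmod (G x) \<le> sqrt (C * exp (size A))"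
      by (intro real_le_rsqrt) force
  qed
  moreover have "0 \<le> (\<Prod>v\<in>#A. r v)" using weight_pos by (intro prod_mset_nonneg) (simp add: r_def less_imp_le)
  ultimately have "(cmod (taylor_coef G A) * (\<Prod>v\<in>#A. r v))\<^sup>2 \<le> (sqrt (C * exp (size A)))\<^sup>2"
    by (intro power_mono) auto
  then have *: "(cmod (taylor_coef G A))\<^sup>2 * (\<Prod>v\<in>#A. (r v)\<^sup>2) \<le> C * exp (size A)"
    using C_nonneg by (simp add: power2_eq_square prod_mset.distrib mult_ac)
  have "real (mi_fact A) = (\<Prod>v\<in>set_mset A. fact (count A v))"
    by (simp add: mi_fact_def)
  also have "\<dots> \<le> (\<Prod>v\<in>set_mset A. ((r v)\<^sup>2 * c v) ^ count A v)"
  proof (rule prod_mono)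
    fix v
    have "(r v)\<^sup>2 * c v = count A v" using weight_pos[of v] by (simp add: r2)
    then show "0 \<le> (fact (count A v) :: real) \<and> fact (count A v) \<le> ((r v)\<^sup>2 * c v) ^ count A v"
      using fact_le_power[of "count A v", where 'a = real] by simp
  qed
  also have "\<dots> = (\<Prod>v\<in>#A. (r v)\<^sup>2) * (\<Prod>v\<in>#A. c v)"
    by (simp add: image_prod_mset_multiplicity power_mult_distrib prod.distrib)
  finally have "(cmod (taylor_coef G A))\<^sup>2 * mi_fact A
      \<le> (cmod (taylor_coef G A))\<^sup>2 * ((\<Prod>v\<in>#A. (r v)\<^sup>2) * (\<Prod>v\<in>#A. c v))"
    by (rule mult_left_mono) simp
  also have "\<dots> \<le> C * exp (size A) * (\<Prod>v\<in>#A. c v)"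
    using mult_right_mono[OF *, of "\<Prod>v\<in>#A. c v"] weight_pos
    by (simp add: prod_mset_nonneg less_imp_le mult.assoc)
  also have "\<dots> = C * (\<Prod>v\<in>#A. exp 1 * c v)"
    by (simp add: prod_mset.distrib exp_of_nat_mult[symmetric])
  finally show ?thesis using mi_fact_pos[of A] by (simp add: le_divide_eq)
qed

text \<open>A truncation and its tail d have disjoint supports, so the quadratic form at truncation
  + z d is P M + |z|^2 (S - P M) without cross terms. As soon as R^2 (S - P M) \<le> 1 the function
  is bounded on the disc of radius R by a constant B independent of M, and passing from z = 0 to z =
  1 changes it by at most (2 B + 1) / R.\<close>

lemma tendsto_truncate:
  assumes x: "x \<in> X"
  shows "(\<lambda>M. G (truncate M x)) \<longlonglongrightarrow> G x"
proof (rule metric_LIMSEQ_I)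
  fix e :: real assume e: "e > 0"
  define a where "a v = c v * (cmod (x v))\<^sup>2" for v
  define S where "S = (\<Sum>\<^sub>\<infinity>v. a v)"
  define P where "P M = (\<Sum>v<M. a v)" for M
  define B where "B = sqrt (C * exp (S + 1))"
  \<comment> \<open>Chosen so that (2 B + 1) / R < e; the maximum with 2 secures R > 1.\<close>
  define R where "R = max 2 ((2 * B + 1) / e + 1)"
  have R: "R > 1" "(2 * B + 1) / R < e"
  proof -
    show "R > 1" by (simp add: R_def)
    have "(2 * B + 1) / e < R" by (simp add: R_def)
    then show "(2 * B + 1) / R < e" using e \<open>R > 1\<close> by (simp add: field_simps)
  qed
  have a0: "a v \<ge> 0" for v using weight_pos[of v] by (simp add: a_def less_imp_le)
  have aS: "(a has_sum S) UNIV"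
    unfolding S_def by (rule has_sum_infsum) (use weight_summable[OF x] in \<open>simp add: a_def[abs_def]\<close>)
  have "P \<longlonglongrightarrow> S"
    using has_sum_imp_sums[OF aS] by (simp add: sums_def P_def[abs_def])
  then have "\<forall>\<^sub>F M in sequentially. dist (P M) S < 1 / R\<^sup>2"
    by (rule tendstoD) (use R in simp)
  then obtain N where N: "\<And>M. M \<ge> N \<Longrightarrow> dist (P M) S < 1 / R\<^sup>2"
    unfolding eventually_sequentially by blast
  have "dist (G (truncate M x)) (G x) < e" if M: "M \<ge> N" for M
  proof -
    define d where "d v = x v - truncate M x v" for v
    define g where "g z = G (\<lambda>v. z * d v + truncate M x v)" for z
    have dX: "d \<in> X" unfolding d_def using tail[OF x] .
    have PS: "P M \<le> S"
      unfolding P_def by (rule finite_sum_le_has_sum[OF aS]) (use a0 in auto)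
    have "S - P M \<le> 1 / R\<^sup>2" using N[OF M] PS by (simp add: dist_real_def)
    then have tl: "R\<^sup>2 * (S - P M) \<le> 1" using R(1) by (simp add: field_simps)
    have "cmod (g z) \<le> B" if z: "cmod z \<le> R" for z
      unfolding B_def
    proof (rule real_le_rsqrt)
      define b where "b v = (if v < M then a v else 0)" for v
      have b: "(b has_sum P M) UNIV"
        by (rule has_sum_finite_neutralI[of "{..<M}"]) (auto simp: b_def P_def)
      have "((\<lambda>v. b v + (cmod z)\<^sup>2 * (a v + (-1) * b v)) has_sum (P M + (cmod z)\<^sup>2 * (S + (-1) * P M))) UNIV"
        by (intro has_sum_add has_sum_cmult_right aS b)
      moreover have "b v + (cmod z)\<^sup>2 * (a v + (-1) * b v) = c v * (cmod (z * d v + truncate M x v))\<^sup>2" for v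
        by (simp add: b_def a_def d_def truncate_def norm_mult power_mult_distrib)
      ultimately have inf: "(\<Sum>\<^sub>\<infinity>v. c v * (cmod (z * d v + truncate M x v))\<^sup>2) = P M + (cmod z)\<^sup>2 * (S - P M)"
        by (simp add: infsumI)
      have "(cmod z)\<^sup>2 * (S - P M) \<le> R\<^sup>2 * (S - P M)"
        using z PS by (intro mult_right_mono power_mono) auto
      then have le: "P M + (cmod z)\<^sup>2 * (S - P M) \<le> S + 1" using tl PS by linarith
      have "(cmod (g z))\<^sup>2 \<le> C * exp (P M + (cmod z)\<^sup>2 * (S - P M))"
        unfolding g_def using bound[OF line_mem[OF truncate_mem dX, of z M x]] unfolding inf .
      also have "\<dots> \<le> C * exp (S + 1)"
        using le C_nonneg by (intro mult_left_mono) auto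
      finally show "(cmod (g z))\<^sup>2 \<le> C * exp (S + 1)" .
    qed
    then have "cmod (g 1 - g 0) \<le> (2 * B + 1) / R"
      unfolding g_def by (intro entire_increment_bound line truncate_mem dX R) auto
    moreover have "g 1 = G x" "g 0 = G (truncate M x)" by (simp_all add: g_def d_def)
    ultimately show ?thesis using R(2) by (simp add: dist_norm norm_minus_commute)
  qed
  then show "\<exists>N. \<forall>M\<ge>N. dist (G (truncate M x)) (G x) < e" by blast
qed

text \<open>The sums over multi-indices in the first M variables are the values at truncations; they
  tend both to the full sum and to \<open>G x\<close>. Summability is assumed here, since square
  sums of x do not control the series; it is supplied for the concrete spaces from the decay of
  mu_j^(-2).\<close>

theorem taylor_expansion:
  assumes x: "x \<in> X" and s: "(\<lambda>A. taylor_coef G A * (\<Prod>v\<in>#A. x v)) summable_on UNIV"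
  shows "((\<lambda>A. taylor_coef G A * (\<Prod>v\<in>#A. x v)) has_sum G x) UNIV"
proof -
  let ?f = "\<lambda>A. taylor_coef G A * (\<Prod>v\<in>#A. x v)"
  have L: "(?f has_sum infsum ?f UNIV) UNIV" using s by (rule has_sum_infsum)
  have "(\<lambda>M. G (truncate M x)) \<longlonglongrightarrow> infsum ?f UNIV"
  proof (rule has_sum_exhaustion[OF L taylor_expansion_finite[OF sep_entire]])
    fix S :: "nat multiset set" assume "finite S"
    then have "finite (\<Union>A\<in>S. set_mset A)" by simp
    then obtain M0 where "(\<Union>A\<in>S. set_mset A) \<subseteq> {..<M0}" using finite_nat_iff_bounded by blast
    then show "\<exists>M0. \<forall>M\<ge>M0. S \<subseteq> {A. set_mset A \<subseteq> {..<M}}"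
      by (intro exI[of _ M0]) fastforce
  qed
  then have "infsum ?f UNIV = G x" using tendsto_truncate[OF x] LIMSEQ_unique by blast
  with L show ?thesis by simp
qed

end

text \<open>A finite set of families lies in the box spanned by its projections, and over a box the
  sum of products is a product of sums.\<close>

lemma prod_fun_summable:
  fixes f :: "'o::finite \<Rightarrow> 'a \<Rightarrow> real"
  assumes f: "\<And>i. f i summable_on UNIV" and nonneg: "\<And>i a. f i a \<ge> 0"
  shows "(\<lambda>A. \<Prod>i\<in>UNIV. f i (A i)) summable_on UNIV"
    and "(\<Sum>\<^sub>\<infinity>A. \<Prod>i\<in>UNIV. f i (A i)) \<le> (\<Prod>i\<in>UNIV. \<Sum>\<^sub>\<infinity>a. f i a)"
proof -
  have bd: "(\<Sum>A\<in>S. \<Prod>i\<in>UNIV. f i (A i)) \<le> (\<Prod>i\<in>UNIV. \<Sum>\<^sub>\<infinity>a. f i a)"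
    if S: "finite S" for S :: "('o \<Rightarrow> 'a) set"
  proof -
    let ?P = "PiE UNIV (\<lambda>i. (\<lambda>A. A i) ` S)"
    have fin: "finite ?P" using S by (intro finite_PiE) auto
    have "(\<Sum>A\<in>S. \<Prod>i\<in>UNIV. f i (A i)) \<le> (\<Sum>A\<in>?P. \<Prod>i\<in>UNIV. f i (A i))"
      using fin nonneg by (intro sum_mono2) (auto simp: prod_nonneg)
    also have "\<dots> = (\<Prod>i\<in>UNIV. \<Sum>a\<in>(\<lambda>A. A i) ` S. f i a)"
      using S by (intro prod_sum_PiE[symmetric]) auto
    also have "\<dots> \<le> (\<Prod>i\<in>UNIV. \<Sum>\<^sub>\<infinity>a. f i a)"
      using S nonneg f by (intro prod_mono conjI sum_nonneg finite_sum_le_infsum) auto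
    finally show ?thesis .
  qed
  show s: "(\<lambda>A. \<Prod>i\<in>UNIV. f i (A i)) summable_on UNIV"
    by (rule nonneg_bounded_partial_sums_imp_summable_on)
      (use bd nonneg in \<open>auto simp: prod_nonneg intro!: eventually_finite_subsets_at_top_weakI\<close>)
  show "(\<Sum>\<^sub>\<infinity>A. \<Prod>i\<in>UNIV. f i (A i)) \<le> (\<Prod>i\<in>UNIV. \<Sum>\<^sub>\<infinity>a. f i a)"
    by (rule infsum_le_finite_sums[OF s]) (use bd in auto)
qed

lemma prod_option_UNIV:
  fixes f :: "'n::finite option \<Rightarrow> 'a::comm_monoid_mult"
  shows "(\<Prod>p\<in>UNIV. f p) = f None * (\<Prod>i\<in>UNIV. f (Some i))"
  by (simp add: UNIV_option_conv prod.reindex)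

lemma sum_option_UNIV:
  fixes f :: "'n::finite option \<Rightarrow> 'a::comm_monoid_add"
  shows "(\<Sum>p\<in>UNIV. f p) = f None + (\<Sum>i\<in>UNIV. f (Some i))"
  by (simp add: UNIV_option_conv sum.reindex)

section \<open>Several slots as one sequence\<close>

text \<open>An enumeration of the pairs (slot, coordinate); the arguments below rely on its
  bijectivity alone.\<close>

definition var_index :: "'o::finite \<times> nat \<Rightarrow> nat" where
  "var_index = to_nat_on UNIV"

lemma bij_var_index: "bij (var_index :: 'o::finite \<times> nat \<Rightarrow> nat)"
  unfolding var_index_def
  by (rule to_nat_on_infinite) (auto simp: finite_prod)

lemma inj_var_index: "inj (var_index :: 'o::finite \<times> nat \<Rightarrow> nat)"
  using bij_var_index by (rule bij_is_inj)

lemma var_index_eq_iff [simp]: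
  "var_index (p, j) = var_index (q, l) \<longleftrightarrow> p = (q :: 'o::finite) \<and> j = l"
  using inj_var_index by (auto dest: injD)

lemma var_index_cases:
  obtains p j where "v = var_index (p :: 'o::finite, j)"
  using bij_is_surj[OF bij_var_index] by (metis surjD prod.exhaust)

definition slot :: "hseq \<Rightarrow> 'o::finite \<Rightarrow> hseq" where
  "slot x p j = x (var_index (p, j))"

definition combine :: "('o::finite \<Rightarrow> hseq) \<Rightarrow> hseq" where
  "combine \<xi> v = (case inv var_index v of (p, j) \<Rightarrow> \<xi> p j)"

lemma slot_combine [simp]: "slot (combine \<xi>) = \<xi>"
  by (intro ext) (simp add: slot_def combine_def inv_f_f[OF inj_var_index])

lemma combine_index [simp]: "combine \<xi> (var_index (p, j)) = \<xi> p j"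
  by (simp add: combine_def inv_f_f[OF inj_var_index])

text \<open>A family of multi-indices, one per slot, as a single multi-index in the merged
  variables. Monomials and factorials factor over the slots, which makes the coefficient bound
  factor as well.\<close>

definition join :: "('o::finite \<Rightarrow> nat multiset) \<Rightarrow> nat multiset" where
  "join A = (\<Sum>p\<in>UNIV. image_mset (\<lambda>j. var_index (p, j)) (A p))"

lemma prod_mset_sum_mset:
  "(\<Prod>v\<in>#(\<Sum>p\<in>S. M p). f v) = (\<Prod>p\<in>S. \<Prod>v\<in>#M p. f v)"
  by (induction S rule: infinite_finite_induct) auto

lemma prod_join:
  "(\<Prod>v\<in>#join A. f v) = (\<Prod>p\<in>UNIV. \<Prod>j\<in>#A p. f (var_index (p, j)))"
  by (simp add: join_def prod_mset_sum_mset image_mset.compositionality o_def)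

lemma mi_fact_join: "mi_fact (join (A :: 'o::finite \<Rightarrow> nat multiset)) = (\<Prod>p\<in>UNIV. mi_fact (A p))"
proof -
  have "mi_fact (\<Sum>p\<in>S. image_mset (\<lambda>j. var_index (p, j)) (A p)) = (\<Prod>p\<in>S. mi_fact (A p))"
    if "finite S" for S :: "'o set"
    using that
  proof (induction S rule: finite_induct)
    case (insert p S)
    have "mi_fact (\<Sum>p\<in>insert p S. image_mset (\<lambda>j. var_index (p, j)) (A p))
        = mi_fact (image_mset (\<lambda>j. var_index (p, j)) (A p))
          * mi_fact (\<Sum>p\<in>S. image_mset (\<lambda>j. var_index (p, j)) (A p))"
      using insert.hyps
      by (simp del: mult_cancel_left, intro mi_fact_add_disjoint) (auto simp: set_mset_sum)
    then show ?case
      using insert by (simp add: mi_fact_image_inj inj_def)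
  qed simp
  then show ?thesis by (simp add: join_def)
qed

lemma count_join: "count (join A) (var_index (p, j)) = count (A p) j"
proof -
  have *: "count (image_mset (\<lambda>j. var_index (q, j)) M) (var_index (p, j)) = (if q = p then count M j else 0)"
    for q and M :: "nat multiset"
    by (induction M) auto
  show ?thesis by (simp add: join_def count_sum *)
qed

text \<open>Multiplicities of the slots can be read off the joined multiset, which gives
  injectivity; surjectivity follows by adding one letter at a time to the slot it belongs
  to.\<close>

lemma bij_join: "bij (join :: ('o::finite \<Rightarrow> nat multiset) \<Rightarrow> nat multiset)"
proof (rule bijI)
  show "inj (join :: ('o \<Rightarrow> nat multiset) \<Rightarrow> nat multiset)"
  proof (rule injI)
    fix A B :: "'o \<Rightarrow> nat multiset" assume "join A = join B"
    then have "count (A p) j = count (B p) j" for p j by (metis count_join)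
    then show "A = B" by (intro ext multiset_eqI)
  qed
  have "\<exists>A :: 'o \<Rightarrow> nat multiset. D = join A" for D
  proof (induction D)
    case empty
    have "join (\<lambda>_ :: 'o. {#}) = {#}" by (simp add: join_def)
    then show ?case by metis
  next
    case (add v D)
    then obtain A :: "'o \<Rightarrow> nat multiset" where A: "D = join A" by blast
    obtain p j where v: "v = var_index (p :: 'o, j)" by (rule var_index_cases)
    have "add_mset v D = join (A(p := add_mset j (A p)))"
    proof (rule multiset_eqI)
      fix w
      obtain q l where w: "w = var_index (q :: 'o, l)" by (rule var_index_cases)
      show "count (add_mset v D) w = count (join (A(p := add_mset j (A p)))) w"
        by (simp add: v w A count_join)
    qed
    then show ?case by blast
  qed
  then show "surj (join :: ('o \<Rightarrow> nat multiset) \<Rightarrow> nat multiset)" by (metis surjI)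
qed

section \<open>The spaces of sequences\<close>

lemma eigval_ge: "eigval j \<ge> 2"
  by (simp add: eigval_def)

lemma eigval_pos [simp]: "eigval j > 0"
  using eigval_ge[of j] by linarith

lemma eigval_nonzero [simp]: "eigval j \<noteq> 0"
  using eigval_pos[of j] by linarith

text \<open>\<open>H_inf\<close> is defined by k \<ge> 0 only; negative k are dominated by k = 0
  because every eigenvalue is at least 2.\<close>

lemma H_infD: "f \<in> H_inf \<Longrightarrow> (\<lambda>j. (cmod (f j))\<^sup>2 * eigval j powr (2 * k)) summable_on UNIV"
proof -
  assume f: "f \<in> H_inf"
  have "(\<lambda>j. (cmod (f j))\<^sup>2 * eigval j powr (2 * max k 0)) summable_on UNIV"
    using f by (auto simp: H_inf_def H_space_def)
  then show ?thesis
    by (rule summable_on_comparison_test) (auto intro!: mult_left_mono powr_mono order_trans[OF _ eigval_ge])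
qed

lemma H_infI:
  "(\<And>k. (\<lambda>j. (cmod (f j))\<^sup>2 * eigval j powr (2 * k)) summable_on UNIV) \<Longrightarrow> f \<in> H_inf"
  by (simp add: H_inf_def H_space_def)

lemma H_inf_finite_support:
  assumes "finite {j. f j \<noteq> 0}"
  shows "f \<in> H_inf"
proof (rule H_infI)
  fix k
  have "(\<lambda>j. (cmod (f j))\<^sup>2 * eigval j powr (2 * k)) summable_on {j. f j \<noteq> 0}"
    using assms by simp
  then show "(\<lambda>j. (cmod (f j))\<^sup>2 * eigval j powr (2 * k)) summable_on UNIV"
    by (rule summable_on_cong_neutral[THEN iffD1, rotated -1]) auto
qed

lemma H_inf_dominated:
  assumes "f \<in> H_inf" "\<And>j. cmod (g j) \<le> cmod (f j)"
  shows "g \<in> H_inf"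
  by (rule H_infI, rule summable_on_comparison_test[OF H_infD[OF assms(1)]])
    (auto intro!: mult_right_mono power_mono assms)

lemma H_inf_affine:
  assumes f: "f \<in> H_inf" and g: "g \<in> H_inf"
  shows "(\<lambda>j. z * f j + g j) \<in> H_inf"
proof (rule H_infI)
  fix k
  let ?w = "\<lambda>j. eigval j powr (2 * k)"
  have "(\<lambda>j. (2 * (cmod z)\<^sup>2) * ((cmod (f j))\<^sup>2 * ?w j) + 2 * ((cmod (g j))\<^sup>2 * ?w j)) summable_on UNIV"
    by (intro summable_on_add summable_on_cmult_right H_infD f g)
  then show "(\<lambda>j. (cmod (z * f j + g j))\<^sup>2 * ?w j) summable_on UNIV"
  proof (rule summable_on_comparison_test)
    fix j
    have "(cmod (z * f j + g j))\<^sup>2 \<le> (cmod z * cmod (f j) + cmod (g j))\<^sup>2"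
      by (intro power_mono) (use norm_triangle_ineq[of "z * f j" "g j"] in \<open>auto simp: norm_mult\<close>)
    also have "\<dots> \<le> 2 * (cmod z * cmod (f j))\<^sup>2 + 2 * (cmod (g j))\<^sup>2"
      using sum_squares_bound[of "cmod z * cmod (f j)" "cmod (g j)"]
      by (simp add: power2_sum)
    finally have "(cmod (z * f j + g j))\<^sup>2 * ?w j
        \<le> (2 * (cmod z * cmod (f j))\<^sup>2 + 2 * (cmod (g j))\<^sup>2) * ?w j"
      by (rule mult_right_mono) simp
    then show "(cmod (z * f j + g j))\<^sup>2 * ?w j
        \<le> (2 * (cmod z)\<^sup>2) * ((cmod (f j))\<^sup>2 * ?w j) + 2 * ((cmod (g j))\<^sup>2 * ?w j)"
      by (simp add: power_mult_distrib algebra_simps)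
  qed simp
qed

lemma H_norm_square: "(H_norm k f)\<^sup>2 = (\<Sum>\<^sub>\<infinity>j. (cmod (f j))\<^sup>2 * eigval j powr (2 * k))"
  unfolding H_norm_def by (rule real_sqrt_pow2) (simp add: infsum_nonneg)

text \<open>Diagonal weights whose quadratic form is the exponent in \<open>O2\<close>: the sum over
  the slots p of \<kappa> p times the squared norm of index \<open>k p\<close>.\<close>

definition slot_weight :: "('o::finite \<Rightarrow> real) \<Rightarrow> ('o \<Rightarrow> real) \<Rightarrow> nat \<Rightarrow> real" where
  "slot_weight \<kappa> k v = (case inv var_index v of (p, j) \<Rightarrow> \<kappa> p * eigval j powr (2 * k p))"

lemma slot_weight_index [simp]: "slot_weight \<kappa> k (var_index (p, j)) = \<kappa> p * eigval j powr (2 * k p)"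
  by (simp add: slot_weight_def inv_f_f[OF inj_var_index])

lemma has_sum_slot_weight:
  assumes x: "\<And>p :: 'o::finite. slot x p \<in> H_inf" and \<kappa>: "\<And>p. \<kappa> p > 0"
  shows "((\<lambda>v. slot_weight \<kappa> k v * (cmod (x v))\<^sup>2) has_sum (\<Sum>p\<in>(UNIV :: 'o set). \<kappa> p * (H_norm (k p) (slot x p))\<^sup>2)) UNIV"
proof -
  let ?f = "\<lambda>v. slot_weight \<kappa> k v * (cmod (x v))\<^sup>2"
  have inner: "((\<lambda>j. ?f (var_index (p, j))) has_sum \<kappa> p * (H_norm (k p) (slot x p))\<^sup>2) UNIV" for p :: 'o
  proof -
    have "((\<lambda>j. \<kappa> p * ((cmod (slot x p j))\<^sup>2 * eigval j powr (2 * k p))) has_sum \<kappa> p * (H_norm (k p) (slot x p))\<^sup>2) UNIV"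
      unfolding H_norm_square by (intro has_sum_cmult_right has_sum_infsum H_infD x)
    then show ?thesis by (simp add: slot_def mult_ac)
  qed
  have "((\<lambda>q. ?f (var_index q)) has_sum (\<Sum>p\<in>(UNIV :: 'o set). \<kappa> p * (H_norm (k p) (slot x p))\<^sup>2)) ((UNIV :: 'o set) \<times> UNIV)"
  proof (rule has_sum_SigmaI[where f = "\<lambda>q. ?f (var_index q)"])
    show "((\<lambda>j. ?f (var_index (p, j))) has_sum \<kappa> p * (H_norm (k p) (slot x p))\<^sup>2) UNIV" for p :: 'o
      by (rule inner)
    show "((\<lambda>p. \<kappa> p * (H_norm (k p) (slot x p))\<^sup>2) has_sum (\<Sum>p\<in>(UNIV :: 'o set). \<kappa> p * (H_norm (k p) (slot x p))\<^sup>2)) UNIV"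
      by (rule has_sum_finiteI) auto
    show "(\<lambda>q. ?f (var_index q)) summable_on ((UNIV :: 'o set) \<times> UNIV)"
    proof (rule summable_on_SigmaI[where f = "\<lambda>q. ?f (var_index q)"])
      show "((\<lambda>j. ?f (var_index (p, j))) has_sum \<kappa> p * (H_norm (k p) (slot x p))\<^sup>2) UNIV" for p :: 'o
        by (rule inner)
      show "(\<lambda>p. \<kappa> p * (H_norm (k p) (slot x p))\<^sup>2) summable_on (UNIV :: 'o set)" by simp
      show "0 \<le> ?f (var_index (p, j))" for p :: 'o and j
        using \<kappa>[of p] by (simp add: less_imp_le)
    qed
  qed
  then show ?thesis
    using has_sum_reindex_bij_betw[OF bij_var_index[where 'o = 'o], of ?f] by simp
qed

text \<open>Restriction to the diagonal where all variables equal t: moving every slot at once with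
  one parameter is a complex line in the merged variables. Complex linearity of the derivative makes
  the chain rule yield a complex derivative.\<close>

lemma entire_line_holomorphic:
  fixes P :: "(complex ^ 'n::finite) \<times> complex \<Rightarrow> complex"
  assumes "entire P"
  shows "(\<lambda>t. P (vec t, t)) holomorphic_on UNIV"
proof -
  have "\<exists>c. ((\<lambda>t. P (vec t, t)) has_field_derivative c) (at t)" for t
  proof -
    obtain D where D: "(P has_derivative D) (at (vec t, t))"
      and lin: "\<And>c v w. D (c *s v, c * w) = c * D (v, w)"
      using assms unfolding entire_def by metis
    have "((\<lambda>t :: complex. vec t :: complex ^ 'n) has_derivative vec) (at t)"
      by (rule bounded_linear_imp_has_derivative) (simp add: linear_conv_bounded_linear[symmetric])
    then have "((\<lambda>t. (vec t :: complex ^ 'n, t)) has_derivative (\<lambda>h. (vec h, h))) (at t)"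
      by (intro has_derivative_Pair has_derivative_ident)
    from diff_chain_at[OF this, unfolded o_def] D
    have "((\<lambda>t. P (vec t, t)) has_derivative (\<lambda>h. D (vec h, h))) (at t)" by blast
    moreover have "(\<lambda>h. D (vec h, h)) = (*) (D (vec 1, 1))"
    proof
      fix h :: complex
      have "vec h = h *s (vec 1 :: complex ^ 'n)" by (simp add: vec_eq_iff)
      then show "D (vec h, h) = D (vec 1, 1) * h" using lin[of h "vec 1" 1] by (simp add: mult.commute)
    qed
    ultimately show ?thesis by (auto simp: has_field_derivative_def)
  qed
  then show ?thesis by (simp add: holomorphic_on_def field_differentiable_def)
qed

text \<open>Slot \<open>None\<close> carries the output variable \<eta>, slot \<open>Some i\<close>
  the input variable number i.\<close>

definition merged :: "(('n::finite \<Rightarrow> hseq) \<Rightarrow> hseq \<Rightarrow> complex) \<Rightarrow> hseq \<Rightarrow> complex" where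
  "merged F x = F (\<lambda>i. slot x (Some i)) (slot x (None :: 'n option))"

definition slot_space :: "'n::finite itself \<Rightarrow> hseq set" where
  "slot_space _ = {x. \<forall>p :: 'n option. slot x p \<in> H_inf}"

lemma merged_gaussian_entire:
  fixes F :: "('n::finite \<Rightarrow> hseq) \<Rightarrow> hseq \<Rightarrow> complex"
  assumes F: "O1 F" and bd: "symbol_bound F k K C k1 K1" and pos: "K > 0" "K1 > 0"
  shows "gaussian_entire (merged F) (slot_space TYPE('n))
    (slot_weight (case_option K (\<lambda>_ :: 'n. K1)) (case_option (- k) (\<lambda>_. k1))) C"
proof
  let ?\<kappa> = "case_option K (\<lambda>_ :: 'n. K1)" and ?k = "case_option (- k) (\<lambda>_ :: 'n. k1)"
  have \<kappa>: "?\<kappa> p > 0" for p using pos by (auto split: option.split)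
  note hs = has_sum_slot_weight[where ?\<kappa> = ?\<kappa> and k = ?k, OF _ \<kappa>]
  show "x \<in> slot_space TYPE('n)" if "finite {v. x v \<noteq> 0}" for x
  proof -
    have "finite {j. slot x p j \<noteq> 0}" for p :: "'n option"
    proof -
      have "{j. slot x p j \<noteq> 0} = (\<lambda>j. var_index (p, j)) -` {v. x v \<noteq> 0}" by (auto simp: slot_def)
      moreover have "inj (\<lambda>j. var_index (p, j))" by (simp add: inj_def)
      ultimately show ?thesis using that by (metis finite_vimageI)
    qed
    then show ?thesis by (simp add: slot_space_def H_inf_finite_support)
  qed
  show "(\<lambda>v. x v - truncate M x v) \<in> slot_space TYPE('n)" if "x \<in> slot_space TYPE('n)" for x M
    unfolding slot_space_def
  proof (intro CollectI allI)
    fix p :: "'n option"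
    show "slot (\<lambda>v. x v - truncate M x v) p \<in> H_inf"
      by (rule H_inf_dominated[of "slot x p"])
        (use that in \<open>auto simp: slot_space_def slot_def truncate_def\<close>)
  qed
  show "(\<lambda>v. z * y v + x v) \<in> slot_space TYPE('n)"
    if "x \<in> slot_space TYPE('n)" "y \<in> slot_space TYPE('n)" for x y z
  proof -
    have "slot (\<lambda>v. z * y v + x v) p = (\<lambda>j. z * slot y p j + slot x p j)" for p :: "'n option"
      by (simp add: slot_def[abs_def])
    then show ?thesis using that by (simp add: slot_space_def H_inf_affine)
  qed
  show "(\<lambda>z. merged F (\<lambda>v. z * y v + x v)) holomorphic_on UNIV"
    if "x \<in> slot_space TYPE('n)" "y \<in> slot_space TYPE('n)" for x y
  proof -
    have "entire (\<lambda>(z, w). F (\<lambda>i j. z $ i * slot y (Some i) j + slot x (Some i) j)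
        (\<lambda>j. w * slot y (None :: 'n option) j + slot x (None :: 'n option) j))"
      by (rule F[unfolded O1_def, rule_format]) (use that in \<open>auto simp: slot_space_def\<close>)
    from entire_line_holomorphic[OF this] show ?thesis
      by (simp add: merged_def slot_def[abs_def])
  qed
  show "slot_weight ?\<kappa> ?k v > 0" for v
    by (cases v rule: var_index_cases[where 'o = "'n option"])
      (simp only: slot_weight_index, intro mult_pos_pos \<kappa>, simp)
  show "(\<lambda>v. slot_weight ?\<kappa> ?k v * (cmod (x v))\<^sup>2) summable_on UNIV" if "x \<in> slot_space TYPE('n)" for x
    using hs[of x] that unfolding slot_space_def summable_on_def by blast
  show "(cmod (merged F x))\<^sup>2 \<le> C * exp (\<Sum>\<^sub>\<infinity>v. slot_weight ?\<kappa> ?k v * (cmod (x v))\<^sup>2)"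
    if x: "x \<in> slot_space TYPE('n)" for x
  proof -
    have "(\<Sum>\<^sub>\<infinity>v. slot_weight ?\<kappa> ?k v * (cmod (x v))\<^sup>2)
        = (\<Sum>p\<in>UNIV. ?\<kappa> p * (H_norm (?k p) (slot x p))\<^sup>2)"
      using hs[of x] x by (simp add: slot_space_def infsumI)
    also have "\<dots> = K1 * (\<Sum>i\<in>(UNIV :: 'n set). (H_norm k1 (slot x (Some i)))\<^sup>2) + K * (H_norm (- k) (slot x (None :: 'n option)))\<^sup>2"
      by (simp add: sum_option_UNIV sum_distrib_left)
    finally show ?thesis
      using bd x unfolding symbol_bound_def merged_def slot_space_def by simp
  qed
qed

section \<open>Estimates in Fock space\<close>

text \<open>The nuclearity of the scale: with eigenvalues 2 (j + 1) this is the series of inverse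
  squares. It is the reason for every shift of k by 1 below.\<close>

lemma summable_eigval: "(\<lambda>j. eigval j powr (- 2)) summable_on UNIV"
proof -
  have "eigval j powr (- 2) = 1 / 4 * (1 / (real j + 1)\<^sup>2)" for j
  proof -
    have "eigval j powr (- 2) = 1 / (eigval j)\<^sup>2" using powr_realpow[of "eigval j" 2] by (simp add: powr_minus_divide)
    also have "(eigval j)\<^sup>2 = 4 * (real j + 1)\<^sup>2" by (simp add: eigval_def power2_eq_square algebra_simps)
    finally show ?thesis by simp
  qed
  moreover have "summable (\<lambda>j. 1 / 4 * (1 / (real j + 1)\<^sup>2))"
    by (intro summable_mult) (use sums_summable[OF inverse_squares_sums] in \<open>simp add: add.commute\<close>)
  ultimately show ?thesis by (simp add: summable_on_UNIV_nonneg_real_iff)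
qed

definition eigval_sum :: real where
  "eigval_sum = (\<Sum>\<^sub>\<infinity>j. eigval j powr (- 2))"

lemma sum_eigval_le: "finite S \<Longrightarrow> (\<Sum>j\<in>S. eigval j powr (- 2)) \<le> eigval_sum"
  unfolding eigval_sum_def by (rule finite_sum_le_infsum[OF summable_eigval]) auto

lemma eigval_sum_pos: "eigval_sum > 0"
proof -
  have "0 < (\<Sum>j\<in>{0}. eigval j powr (- 2))" by simp
  also have "\<dots> \<le> eigval_sum" by (rule sum_eigval_le) simp
  finally show ?thesis .
qed

text \<open>Normalised to total mass 1/2, so that the multinomial sums are bounded by 1 / (1 - 1/2)
  = 2.\<close>

definition half_weight :: "nat \<Rightarrow> real" where
  "half_weight j = eigval j powr (- 2) / (2 * eigval_sum)"

lemma half_weight_pos [simp]: "half_weight j > 0"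
  using eigval_sum_pos by (simp add: half_weight_def)

lemma half_weight_nonneg [simp]: "half_weight j \<ge> 0"
  by (rule less_imp_le) simp

lemma sum_half_weight_le: "finite S \<Longrightarrow> sum half_weight S \<le> 1 / 2"
  using sum_eigval_le[of S] eigval_sum_pos
  by (simp add: half_weight_def flip: sum_divide_distrib)

lemma sum_multinomial_half_weight_le:
  "finite S \<Longrightarrow> (\<Sum>A\<in>S. fact (size A) / mi_fact A * (\<Prod>j\<in>#A. half_weight j)) \<le> 2"
  using sum_multinomial_le[of half_weight "1 / 2" S] sum_half_weight_le by simp

lemma sum_prod_half_weight_le: "finite S \<Longrightarrow> (\<Sum>A\<in>S. \<Prod>j\<in>#A. half_weight j) \<le> 2"
  using sum_prod_mset_le[of half_weight "1 / 2" S] sum_half_weight_le by simp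

section \<open>Weighted norms and coefficient bounds, one slot at a time\<close>

lemma W_term_eq:
  "W_term k C \<phi> A = (cmod (\<phi> A))\<^sup>2 * fact (size A) * (\<Prod>j\<in>#A. C\<^sup>2 * eigval j powr (2 * k))"
proof -
  have "mi_weight A > 0" unfolding mi_weight_def by (induction A) auto
  moreover have "mi_weight A powr (2 * k) = (\<Prod>j\<in>#A. eigval j powr (2 * k))"
    unfolding mi_weight_def
    by (induction A) (auto simp: powr_mult prod_mset_nonneg less_imp_le)
  moreover have "C ^ (2 * size A) = (\<Prod>j\<in>#A. C\<^sup>2)"
    by (simp add: power_mult)
  ultimately show ?thesis
    by (simp only: W_term_def prod_mset.distrib) (simp add: mult_ac)
qed

lemma W_term_nonneg: "W_term k C \<phi> A \<ge> 0"
  unfolding W_term_eq by (intro mult_nonneg_nonneg prod_mset_nonneg) auto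

lemma W_norm_nonneg: "W_norm k C \<phi> \<ge> 0"
  by (simp add: W_norm_def infsum_nonneg W_term_nonneg)

lemma W_infD: "\<phi> \<in> W_inf \<Longrightarrow> k > 0 \<Longrightarrow> C > 0 \<Longrightarrow> W_term k C \<phi> summable_on UNIV"
  by (auto simp: W_inf_def W_space_def)

lemma W_infI: "(\<And>k C. k > 0 \<Longrightarrow> C > 0 \<Longrightarrow> W_term k C \<phi> summable_on UNIV) \<Longrightarrow> \<phi> \<in> W_inf"
  by (auto simp: W_inf_def W_space_def)

lemma W_bounded_sums:
  assumes "\<And>S. finite S \<Longrightarrow> (\<Sum>A\<in>S. W_term k C \<phi> A) \<le> D\<^sup>2" and "D \<ge> 0"
  shows "W_term k C \<phi> summable_on UNIV" and "W_norm k C \<phi> \<le> D"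
proof -
  show s: "W_term k C \<phi> summable_on UNIV"
    by (rule nonneg_bounded_partial_sums_imp_summable_on)
      (use assms W_term_nonneg in \<open>auto intro!: eventually_finite_subsets_at_top_weakI\<close>)
  have "(\<Sum>\<^sub>\<infinity>A. W_term k C \<phi> A) \<le> D\<^sup>2"
    by (rule infsum_le_finite_sums[OF s]) (use assms in auto)
  then show "W_norm k C \<phi> \<le> D"
    unfolding W_norm_def using assms(2) by (simp add: real_le_lsqrt)
qed

text \<open>The contribution of one slot to the bound on a Taylor coefficient: the square root of (e
  c)^A / A! with c_j = K mu_j^(2k).\<close>

definition coef_weight :: "real \<Rightarrow> real \<Rightarrow> nat multiset \<Rightarrow> real" where
  "coef_weight k K A = sqrt ((\<Prod>j\<in>#A. exp 1 * (K * eigval j powr (2 * k))) / mi_fact A)"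

lemma coef_weight_nonneg: "K > 0 \<Longrightarrow> coef_weight k K A \<ge> 0"
  unfolding coef_weight_def by (auto intro!: divide_nonneg_nonneg prod_mset_nonneg)

lemma coef_weight_square:
  "K > 0 \<Longrightarrow> (coef_weight k K A)\<^sup>2 = (\<Prod>j\<in>#A. exp 1 * (K * eigval j powr (2 * k))) / mi_fact A"
  unfolding coef_weight_def
  by (rule real_sqrt_pow2) (auto intro!: divide_nonneg_nonneg prod_mset_nonneg)

lemma prod_mset_pos: "(\<And>v. f v > 0) \<Longrightarrow> (\<Prod>v\<in>#A. f v) > (0::real)"
  by (induction A) auto

text \<open>The C for which e K mu_j^(2k) is at most \<open>half_weight j\<close> times C^2
  mu_j^(2(|k|+1)).\<close>

definition source_const :: "real \<Rightarrow> real" where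
  "source_const K = sqrt (2 * exp 1 * K * eigval_sum)"

lemma source_const_pos: "K > 0 \<Longrightarrow> source_const K > 0"
  using eigval_sum_pos by (simp add: source_const_def)

text \<open>Cauchy-Schwarz against the Fock norm. The squares of the complementary factor are
  A!/|A|! times a quotient of weights, hence at most the product of \<open>half_weight\<close> over
  A. The index |k| + 1 leaves room for mu_j^(-2) and is positive, as the spaces W require.\<close>

lemma coef_weight_pairing:
  assumes \<phi>: "\<phi> \<in> W_inf" and K: "K > 0"
  shows "(\<lambda>A. cmod (\<phi> A) * mi_fact A * coef_weight k K A) summable_on UNIV"
    and "(\<Sum>\<^sub>\<infinity>A. cmod (\<phi> A) * mi_fact A * coef_weight k K A)
      \<le> sqrt 2 * W_norm (\<bar>k\<bar> + 1) (source_const K) \<phi>"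
proof -
  let ?k = "\<bar>k\<bar> + 1" and ?C = "source_const K"
  let ?f = "\<lambda>A. cmod (\<phi> A) * mi_fact A * coef_weight k K A"
  have C: "?C > 0" "?C\<^sup>2 = 2 * exp 1 * K * eigval_sum"
    using source_const_pos[OF K] K eigval_sum_pos by (auto simp: source_const_def)
  have sW: "W_term ?k ?C \<phi> summable_on UNIV"
    by (rule W_infD[OF \<phi>]) (use C in auto)
  \<comment> \<open>\<open>Q\<close> is the weight of the Fock norm and \<open>N\<close> that of the
    coefficients, both without factorials; \<open>v\<close> is what remains for the second
    Cauchy-Schwarz factor.\<close>
  define Q where "Q A = (\<Prod>j\<in>#A. ?C\<^sup>2 * eigval j powr (2 * ?k))" for A
  define N where "N A = (\<Prod>j\<in>#A. exp 1 * (K * eigval j powr (2 * k)))" for A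
  define v where "v A = mi_fact A * coef_weight k K A / sqrt (fact (size A) * Q A)" for A
  have Q: "Q A > 0" for A
    unfolding Q_def using C(1) by (intro prod_mset_pos) simp
  have N: "N A \<ge> 0" for A
    unfolding N_def using K by (intro prod_mset_nonneg) simp
  have f_eq: "?f A = sqrt (W_term ?k ?C \<phi> A) * v A" for A
  proof -
    have "sqrt (W_term ?k ?C \<phi> A) = cmod (\<phi> A) * sqrt (fact (size A) * Q A)"
      unfolding W_term_eq Q_def[symmetric] by (simp add: real_sqrt_mult mult.assoc)
    moreover have "sqrt (fact (size A) * Q A) \<noteq> 0"
      using Q[of A] by simp
    ultimately show ?thesis by (simp add: v_def)
  qed
  have v2: "(v A)\<^sup>2 \<le> (\<Prod>j\<in>#A. half_weight j)" for A
  proof -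
    have "(v A)\<^sup>2 = mi_fact A * N A / (fact (size A) * Q A)"
      using Q[of A] unfolding v_def power_divide power_mult_distrib coef_weight_square[OF K] N_def[symmetric]
      by (simp add: power2_eq_square)
    also have "\<dots> = mi_fact A / fact (size A) * (N A / Q A)" by simp
    also have "\<dots> \<le> 1 * (N A / Q A)"
    proof (rule mult_right_mono)
      show "mi_fact A / fact (size A) \<le> (1::real)"
        using of_nat_mono[OF mi_fact_le[of A], where 'a = real] by simp
      show "0 \<le> N A / Q A"
        using N[of A] Q[of A] by simp
    qed
    also have "1 * (N A / Q A) \<le> (\<Prod>j\<in>#A. half_weight j)"
    proof -
      have "N A \<le> (\<Prod>j\<in>#A. half_weight j) * Q A"
        unfolding N_def Q_def prod_mset.distrib[symmetric]
      proof (rule prod_mset_mono)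
        fix j
        have "eigval j powr (2 * k) \<le> eigval j powr (- 2 + 2 * ?k)"
          using eigval_ge[of j] by (intro powr_mono) auto
        then have "exp 1 * (K * eigval j powr (2 * k)) \<le> exp 1 * (K * (eigval j powr (- 2) * eigval j powr (2 * ?k)))"
          using K unfolding powr_add by (intro mult_left_mono) auto
        also have "\<dots> = half_weight j * (?C\<^sup>2 * eigval j powr (2 * ?k))"
          using eigval_sum_pos by (simp add: half_weight_def C(2))
        finally show "exp 1 * (K * eigval j powr (2 * k)) \<le> half_weight j * (?C\<^sup>2 * eigval j powr (2 * ?k))" .
      qed (use K in auto)
      then show ?thesis
        using Q[of A] by (simp add: divide_le_eq)
    qed
    finally show ?thesis .
  qed
  have bd: "sum ?f S \<le> sqrt 2 * W_norm ?k ?C \<phi>" if S: "finite S" for S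
  proof -
    have "(sum ?f S)\<^sup>2 = (\<Sum>A\<in>S. sqrt (W_term ?k ?C \<phi> A) * v A)\<^sup>2" by (simp only: f_eq)
    also have "\<dots> \<le> (\<Sum>A\<in>S. (sqrt (W_term ?k ?C \<phi> A))\<^sup>2) * (\<Sum>A\<in>S. (v A)\<^sup>2)"
      by (rule Cauchy_Schwarz_ineq_sum)
    also have "\<dots> = (\<Sum>A\<in>S. W_term ?k ?C \<phi> A) * (\<Sum>A\<in>S. (v A)\<^sup>2)"
      by (simp add: W_term_nonneg)
    also have "\<dots> \<le> (\<Sum>\<^sub>\<infinity>A. W_term ?k ?C \<phi> A) * 2"
    proof (rule mult_mono)
      show "(\<Sum>A\<in>S. W_term ?k ?C \<phi> A) \<le> (\<Sum>\<^sub>\<infinity>A. W_term ?k ?C \<phi> A)"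
        by (rule finite_sum_le_infsum[OF sW S]) (auto simp: W_term_nonneg)
      show "(\<Sum>A\<in>S. (v A)\<^sup>2) \<le> 2"
        using sum_mono[of S "\<lambda>A. (v A)\<^sup>2", OF v2] sum_prod_half_weight_le[OF S] by linarith
    qed (auto intro!: infsum_nonneg sum_nonneg W_term_nonneg)
    also have "\<dots> = (sqrt 2 * W_norm ?k ?C \<phi>)\<^sup>2"
      by (simp add: W_norm_def power_mult_distrib infsum_nonneg W_term_nonneg)
    finally show ?thesis
      by (rule power2_le_imp_le) (simp add: W_norm_nonneg)
  qed
  have f0: "?f A \<ge> 0" for A using coef_weight_nonneg[OF K] by simp
  show s: "?f summable_on UNIV"
    by (rule nonneg_bounded_partial_sums_imp_summable_on)
      (use bd f0 in \<open>auto intro!: eventually_finite_subsets_at_top_weakI\<close>)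
  show "infsum ?f UNIV \<le> sqrt 2 * W_norm ?k ?C \<phi>"
    by (rule infsum_le_finite_sums[OF s]) (use bd in auto)
qed

text \<open>The solution K of e K C'^2 \<open>eigval_sum\<close> = 1/2.\<close>

definition target_const :: "real \<Rightarrow> real" where
  "target_const C' = 1 / (2 * exp 1 * C'\<^sup>2 * eigval_sum)"

lemma target_const_pos: "C' > 0 \<Longrightarrow> target_const C' > 0"
  using eigval_sum_pos by (simp add: target_const_def)

text \<open>The |B|! of the norm meets the 1/B! of the coefficients, so the full multinomial series
  appears, and that converges only if its variables add up to less than 1. The indices k' and -(k' +
  1) leave mu_j^(-2), and the choice of K turns the variables into
  \<open>half_weight\<close>.\<close>

lemma W_target_bound:
  assumes C': "C' > 0" and D: "D \<ge> 0"
    and \<psi>: "\<And>B. cmod (\<psi> B) \<le> D * coef_weight (- (k' + 1)) (target_const C') B"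
  shows "W_term k' C' \<psi> summable_on UNIV" and "W_norm k' C' \<psi> \<le> sqrt 2 * D"
proof -
  have bd: "(\<Sum>B\<in>S. W_term k' C' \<psi> B) \<le> (sqrt 2 * D)\<^sup>2" if S: "finite S" for S
  proof -
    have "W_term k' C' \<psi> B \<le> D\<^sup>2 * (fact (size B) / mi_fact B * (\<Prod>j\<in>#B. half_weight j))" for B
    proof -
      have "(cmod (\<psi> B))\<^sup>2 \<le> (D * coef_weight (- (k' + 1)) (target_const C') B)\<^sup>2"
        by (intro power_mono \<psi>) simp
      also have "\<dots> = D\<^sup>2 * ((\<Prod>j\<in>#B. exp 1 * (target_const C' * eigval j powr (2 * - (k' + 1)))) / mi_fact B)"
        unfolding power_mult_distrib coef_weight_square[OF target_const_pos[OF C']] ..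
      finally have le: "(cmod (\<psi> B))\<^sup>2 \<le> D\<^sup>2 * ((\<Prod>j\<in>#B. exp 1 * (target_const C' * eigval j powr (2 * - (k' + 1)))) / mi_fact B)" .
      have "W_term k' C' \<psi> B \<le> D\<^sup>2 * ((\<Prod>j\<in>#B. exp 1 * (target_const C' * eigval j powr (2 * - (k' + 1)))) / mi_fact B)
          * (fact (size B) * (\<Prod>j\<in>#B. C'\<^sup>2 * eigval j powr (2 * k')))"
        unfolding W_term_eq mult.assoc[of "(cmod (\<psi> B))\<^sup>2"]
        by (rule mult_right_mono[OF le])
          (auto intro!: mult_nonneg_nonneg prod_mset_nonneg)
      also have "\<dots> = D\<^sup>2 * (fact (size B) / mi_fact B * (\<Prod>j\<in>#B. exp 1 * (target_const C' * eigval j powr (2 * - (k' + 1))) * (C'\<^sup>2 * eigval j powr (2 * k'))))"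
        by (simp only: prod_mset.distrib) (simp add: mult_ac)
      also have "(\<lambda>j. exp 1 * (target_const C' * eigval j powr (2 * - (k' + 1))) * (C'\<^sup>2 * eigval j powr (2 * k'))) = half_weight"
      proof
        fix j
        have "eigval j powr (- 2) = eigval j powr (2 * - (k' + 1)) * eigval j powr (2 * k')"
          by (simp add: algebra_simps flip: powr_add)
        then show "exp 1 * (target_const C' * eigval j powr (2 * - (k' + 1))) * (C'\<^sup>2 * eigval j powr (2 * k')) = half_weight j"
          using C' eigval_sum_pos by (simp add: half_weight_def target_const_def)
      qed
      finally show ?thesis .
    qed
    then have "(\<Sum>B\<in>S. W_term k' C' \<psi> B) \<le> (\<Sum>B\<in>S. D\<^sup>2 * (fact (size B) / mi_fact B * (\<Prod>j\<in>#B. half_weight j)))"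
      by (rule sum_mono)
    also have "\<dots> = D\<^sup>2 * (\<Sum>B\<in>S. fact (size B) / mi_fact B * (\<Prod>j\<in>#B. half_weight j))"
      by (rule sum_distrib_left[symmetric])
    also have "\<dots> \<le> D\<^sup>2 * 2"
      by (intro mult_left_mono sum_multinomial_half_weight_le S) simp
    finally show ?thesis by (simp add: power_mult_distrib mult.commute)
  qed
  show "W_term k' C' \<psi> summable_on UNIV" "W_norm k' C' \<psi> \<le> sqrt 2 * D"
    by (rule W_bounded_sums[OF bd]; use D in simp)+
qed

text \<open>The factorial in the pairing cancels the one in the coherent vector: pairing with a
  coherent vector evaluates a power series at \<xi>.\<close>

lemma coherent_mult_mi_fact: "coherent \<xi> A * of_nat (mi_fact A) = (\<Prod>j\<in>#A. \<xi> j)"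
proof -
  have "coherent \<xi> A * of_nat (mi_fact A) = (\<Prod>i\<in>set_mset A. \<xi> i ^ count A i)"
    unfolding coherent_eq mi_fact_def of_nat_prod prod.distrib[symmetric] by simp
  then show ?thesis by (simp add: image_prod_mset_multiplicity)
qed

lemma power_div_fact_le_exp:
  fixes t :: real
  assumes "t \<ge> 0"
  shows "t ^ n / fact n \<le> exp t"
proof -
  have "(\<lambda>n. t ^ n / fact n) sums exp t"
    using exp_converges[of t] by (simp add: divide_inverse mult.commute)
  then have "(\<Sum>i\<in>{n}. t ^ i / fact i) \<le> exp t"
    by (intro sum_le_suminf[of "\<lambda>n. t ^ n / fact n" "{n}", THEN order_trans])
      (use assms in \<open>auto simp: sums_iff\<close>)
  then show ?thesis by simp
qed

text \<open>
  With \<open>y\<^sub>j = C\<^sup>2 \<mu>\<^sub>j\<^sup>2\<^sup>k |\<xi>\<^sub>j|\<^sup>2\<close>, one of the two factors \<open>1/A!\<close> in \<open>|coherent \<xi> A|\<^sup>2\<close> turns \<open>y\<^sup>A\<close> into at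
  most \<open>exp (\<Sum>j. y\<^sub>j / z\<^sub>j) z\<^sup>A\<close>, where \<open>z\<close> may be chosen with \<open>\<Sum>j. z\<^sub>j < 1\<close>.
\<close>

lemma coherent_W_inf:
  assumes \<xi>: "\<xi> \<in> H_inf"
  shows "coherent \<xi> \<in> W_inf"
proof (rule W_infI)
  fix k C :: real assume C: "C > 0"
  define t where "t j = C\<^sup>2 * (cmod (\<xi> j))\<^sup>2 * eigval j powr (2 * k) / half_weight j" for j
  \<comment> \<open>Dividing by \<open>half_weight\<close> costs one step in the scale: t consists
    of multiples of the terms of the squared norm of index k + 1, finite for \<xi> in
    \<open>H_inf\<close>.\<close>
  have t_eq: "t j = 2 * eigval_sum * C\<^sup>2 * ((cmod (\<xi> j))\<^sup>2 * eigval j powr (2 * (k + 1)))" for j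
  proof -
    have "eigval j powr (2 * (k + 1)) = eigval j powr (2 * k) / eigval j powr (- 2)"
      by (simp add: algebra_simps flip: powr_diff)
    then show ?thesis using eigval_sum_pos by (simp add: t_def half_weight_def)
  qed
  have st: "t summable_on UNIV"
    unfolding t_eq[abs_def] by (intro summable_on_cmult_right H_infD \<xi>)
  have t0: "t j \<ge> 0" for j by (simp add: t_def)
  define T where "T = exp (infsum t UNIV)"
  have T: "(\<Prod>j\<in>#A. t j) / mi_fact A \<le> T" for A
  proof -
    have "(\<Prod>j\<in>#A. t j) / mi_fact A = (\<Prod>j\<in>set_mset A. t j ^ count A j / fact (count A j))"
      by (simp add: image_prod_mset_multiplicity mi_fact_def prod_dividef)
    also have "\<dots> \<le> (\<Prod>j\<in>set_mset A. exp (t j))"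
      using t0 by (intro prod_mono conjI power_div_fact_le_exp) auto
    also have "\<dots> = exp (\<Sum>j\<in>set_mset A. t j)" by (simp add: exp_sum)
    also have "\<dots> \<le> T"
      unfolding T_def using t0 st by (auto intro!: finite_sum_le_infsum)
    finally show ?thesis .
  qed
  have bd: "(\<Sum>A\<in>S. W_term k C (coherent \<xi>) A) \<le> (sqrt (2 * T))\<^sup>2" if S: "finite S" for S
  proof -
    have "W_term k C (coherent \<xi>) A \<le> T * (fact (size A) / mi_fact A * (\<Prod>j\<in>#A. half_weight j))" for A
    proof -
      have "cmod (coherent \<xi> A) * mi_fact A = (\<Prod>j\<in>#A. cmod (\<xi> j))"
        using arg_cong[OF coherent_mult_mi_fact[of \<xi> A], of cmod] by (simp add: norm_mult norm_prod_mset)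
      then have "cmod (coherent \<xi> A) = (\<Prod>j\<in>#A. cmod (\<xi> j)) / mi_fact A" by (simp add: field_simps)
      then have "(cmod (coherent \<xi> A))\<^sup>2 = (\<Prod>j\<in>#A. (cmod (\<xi> j))\<^sup>2) / (mi_fact A)\<^sup>2"
        by (simp add: power_divide power2_eq_square prod_mset.distrib)
      then have "W_term k C (coherent \<xi>) A
          = fact (size A) / (mi_fact A)\<^sup>2 * ((\<Prod>j\<in>#A. (cmod (\<xi> j))\<^sup>2) * (\<Prod>j\<in>#A. C\<^sup>2 * eigval j powr (2 * k)))"
        by (simp add: W_term_eq)
      also have "(\<Prod>j\<in>#A. (cmod (\<xi> j))\<^sup>2) * (\<Prod>j\<in>#A. C\<^sup>2 * eigval j powr (2 * k)) = (\<Prod>j\<in>#A. t j * half_weight j)"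
        unfolding prod_mset.distrib[symmetric] by (simp add: t_def less_imp_neq[OF half_weight_pos, symmetric] mult_ac)
      also have "fact (size A) / (mi_fact A)\<^sup>2 * (\<Prod>j\<in>#A. t j * half_weight j)
          = (\<Prod>j\<in>#A. t j) / mi_fact A * (fact (size A) / mi_fact A * (\<Prod>j\<in>#A. half_weight j))"
        by (simp add: prod_mset.distrib power2_eq_square)
      also have "\<dots> \<le> T * (fact (size A) / mi_fact A * (\<Prod>j\<in>#A. half_weight j))"
        by (intro mult_right_mono T mult_nonneg_nonneg prod_mset_nonneg) auto
      finally show ?thesis .
    qed
    then have "(\<Sum>A\<in>S. W_term k C (coherent \<xi>) A) \<le> (\<Sum>A\<in>S. T * (fact (size A) / mi_fact A * (\<Prod>j\<in>#A. half_weight j)))"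
      by (rule sum_mono)
    also have "\<dots> = T * (\<Sum>A\<in>S. fact (size A) / mi_fact A * (\<Prod>j\<in>#A. half_weight j))"
      by (rule sum_distrib_left[symmetric])
    also have "\<dots> \<le> T * 2"
      by (intro mult_left_mono sum_multinomial_half_weight_le S) (simp add: T_def)
    finally show ?thesis by (simp add: T_def)
  qed
  show "W_term k C (coherent \<xi>) summable_on UNIV"
    by (rule W_bounded_sums(1)[OF bd]) (auto simp: T_def)
qed

section \<open>The operator of a symbol\<close>

text \<open>The factors A_i! come from the pairing, so that coherent inputs produce monomials in the
  \<xi>^i. No B! occurs, because pairing the output with a coherent vector already produces the
  monomial \<eta>^B.\<close>

definition symbol_operator :: "(('n::finite \<Rightarrow> hseq) \<Rightarrow> hseq \<Rightarrow> complex) \<Rightarrow> ('n \<Rightarrow> fock) \<Rightarrow> fock" where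
  "symbol_operator F \<phi> B =
     (\<Sum>\<^sub>\<infinity>A. (\<Prod>i\<in>UNIV. \<phi> i (A i) * of_nat (mi_fact (A i)))
        * taylor_coef (merged F) (join (case_option B A)))"

lemma taylor_coef_join_bound:
  fixes F :: "('n::finite \<Rightarrow> hseq) \<Rightarrow> hseq \<Rightarrow> complex" and A :: "'n \<Rightarrow> nat multiset"
  assumes F: "O1 F" and bd: "symbol_bound F k K C k1 K1" and pos: "C > 0" "K > 0" "K1 > 0"
  shows "cmod (taylor_coef (merged F) (join (case_option B A)))
    \<le> sqrt C * coef_weight (- k) K B * (\<Prod>i\<in>UNIV. coef_weight k1 K1 (A i))"
proof (rule power2_le_imp_le)
  let ?A = "case_option B A"
  let ?\<kappa> = "case_option K (\<lambda>_ :: 'n. K1)" and ?k = "case_option (- k) (\<lambda>_ :: 'n. k1)"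
  let ?w = "\<lambda>p. coef_weight (?k p) (?\<kappa> p) (?A p)"
  have \<kappa>: "?\<kappa> p > 0" for p using pos by (auto split: option.split)
  interpret gaussian_entire "merged F" "slot_space TYPE('n)" "slot_weight ?\<kappa> ?k" C
    by (rule merged_gaussian_entire[OF F bd]) (use pos in auto)
  have "(cmod (taylor_coef (merged F) (join ?A)))\<^sup>2
      \<le> C * (\<Prod>v\<in>#join ?A. exp 1 * slot_weight ?\<kappa> ?k v) / mi_fact (join ?A)"
    by (rule taylor_coef_bound)
  also have "\<dots> = C * (\<Prod>p\<in>UNIV. (?w p)\<^sup>2)"
    unfolding prod_join mi_fact_join coef_weight_square[OF \<kappa>] of_nat_prod prod_dividef by simp
  also have "\<dots> = (sqrt C * (\<Prod>p\<in>UNIV. ?w p))\<^sup>2"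
    using pos by (simp add: power_mult_distrib prod_power_distrib)
  also have "(\<Prod>p\<in>UNIV. ?w p) = coef_weight (- k) K B * (\<Prod>i\<in>UNIV. coef_weight k1 K1 (A i))"
    by (simp add: prod_option_UNIV)
  finally show "(cmod (taylor_coef (merged F) (join ?A)))\<^sup>2
      \<le> (sqrt C * coef_weight (- k) K B * (\<Prod>i\<in>UNIV. coef_weight k1 K1 (A i)))\<^sup>2"
    by (simp add: mult.assoc)
  show "0 \<le> sqrt C * coef_weight (- k) K B * (\<Prod>i\<in>UNIV. coef_weight k1 K1 (A i))"
    using pos by (intro mult_nonneg_nonneg prod_nonneg coef_weight_nonneg) auto
qed

lemma symbol_operator_bound:
  fixes F :: "('n::finite \<Rightarrow> hseq) \<Rightarrow> hseq \<Rightarrow> complex"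
  assumes F: "O1 F" and bd: "symbol_bound F k K C k1 K1" and pos: "C > 0" "K > 0" "K1 > 0"
    and \<phi>: "\<And>i. \<phi> i \<in> W_inf"
  shows "(\<lambda>A. norm ((\<Prod>i\<in>UNIV. \<phi> i (A i) * of_nat (mi_fact (A i)))
        * taylor_coef (merged F) (join (case_option B A)))) summable_on UNIV" (is "?t summable_on UNIV")
    and "cmod (symbol_operator F \<phi> B)
      \<le> sqrt C * (\<Prod>i\<in>UNIV. sqrt 2 * W_norm (\<bar>k1\<bar> + 1) (source_const K1) (\<phi> i)) * coef_weight (- k) K B"
proof -
  define f where "f i A = cmod (\<phi> i A) * mi_fact A * coef_weight k1 K1 A" for i A
  have f0: "f i A \<ge> 0" for i A using coef_weight_nonneg[OF pos(3)] by (simp add: f_def)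
  have fs: "f i summable_on UNIV" and fi: "infsum (f i) UNIV \<le> sqrt 2 * W_norm (\<bar>k1\<bar> + 1) (source_const K1) (\<phi> i)" for i
    unfolding f_def by (rule coef_weight_pairing[OF \<phi> pos(3)])+
  let ?D = "sqrt C * coef_weight (- k) K B"
  have D: "?D \<ge> 0" using pos coef_weight_nonneg by simp
  have t: "?t A \<le> ?D * (\<Prod>i\<in>UNIV. f i (A i))" for A
  proof -
    have "?t A = (\<Prod>i\<in>UNIV. cmod (\<phi> i (A i)) * mi_fact (A i)) * cmod (taylor_coef (merged F) (join (case_option B A)))"
      by (simp add: norm_mult prod_norm[symmetric])
    also have "\<dots> \<le> (\<Prod>i\<in>UNIV. cmod (\<phi> i (A i)) * mi_fact (A i)) * (?D * (\<Prod>i\<in>UNIV. coef_weight k1 K1 (A i)))"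
      by (intro mult_left_mono taylor_coef_join_bound[OF F bd pos] prod_nonneg) auto
    also have "\<dots> = ?D * (\<Prod>i\<in>UNIV. f i (A i))"
      by (simp add: f_def prod.distrib mult_ac)
    finally show ?thesis .
  qed
  have s: "(\<lambda>A. ?D * (\<Prod>i\<in>UNIV. f i (A i))) summable_on UNIV"
    by (intro summable_on_cmult_right prod_fun_summable(1) fs f0)
  show st: "?t summable_on UNIV"
    by (rule summable_on_comparison_test[OF s t]) simp
  have "cmod (symbol_operator F \<phi> B) \<le> infsum ?t UNIV"
    unfolding symbol_operator_def by (rule norm_infsum_bound[OF st])
  also have "\<dots> \<le> (\<Sum>\<^sub>\<infinity>A. ?D * (\<Prod>i\<in>UNIV. f i (A i)))"
    by (rule infsum_mono[OF st s t])
  also have "\<dots> = ?D * (\<Sum>\<^sub>\<infinity>A. \<Prod>i\<in>UNIV. f i (A i))"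
    by (rule infsum_cmult_right')
  also have "\<dots> \<le> ?D * (\<Prod>i\<in>UNIV. infsum (f i) UNIV)"
    by (intro mult_left_mono prod_fun_summable(2) fs f0 D)
  also have "\<dots> \<le> ?D * (\<Prod>i\<in>UNIV. sqrt 2 * W_norm (\<bar>k1\<bar> + 1) (source_const K1) (\<phi> i))"
    by (intro mult_left_mono prod_mono conjI fi D infsum_nonneg f0)
  finally show "cmod (symbol_operator F \<phi> B)
      \<le> sqrt C * (\<Prod>i\<in>UNIV. sqrt 2 * W_norm (\<bar>k1\<bar> + 1) (source_const K1) (\<phi> i)) * coef_weight (- k) K B"
    by (simp add: mult_ac)
qed

text \<open>The instance k = k' + 1, K = \<open>target_const C'\<close> of \<open>O2\<close> gives
  the coefficient decay that the target norm (k', C') asks for.\<close>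

lemma symbol_operator_target:
  fixes F :: "('n::finite \<Rightarrow> hseq) \<Rightarrow> hseq \<Rightarrow> complex"
  assumes F: "O1 F" and bd: "symbol_bound F (k' + 1) (target_const C') C k1 K1"
    and pos: "C > 0" "K1 > 0" "C' > 0" and \<phi>: "\<And>i. \<phi> i \<in> W_inf"
  shows "W_term k' C' (symbol_operator F \<phi>) summable_on UNIV"
    and "W_norm k' C' (symbol_operator F \<phi>)
      \<le> sqrt 2 * sqrt C * sqrt 2 ^ CARD('n) * (\<Prod>i\<in>UNIV. W_norm (\<bar>k1\<bar> + 1) (source_const K1) (\<phi> i))"
proof -
  let ?D = "sqrt C * (\<Prod>i\<in>UNIV. sqrt 2 * W_norm (\<bar>k1\<bar> + 1) (source_const K1) (\<phi> i))"
  have D: "?D \<ge> 0" using pos W_norm_nonneg by (intro mult_nonneg_nonneg prod_nonneg) auto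
  note b = symbol_operator_bound(2)[OF F bd pos(1) target_const_pos[OF pos(3)] pos(2) \<phi>]
  show "W_term k' C' (symbol_operator F \<phi>) summable_on UNIV"
    by (rule W_target_bound(1)[OF pos(3) D b])
  show "W_norm k' C' (symbol_operator F \<phi>)
      \<le> sqrt 2 * sqrt C * sqrt 2 ^ CARD('n) * (\<Prod>i\<in>UNIV. W_norm (\<bar>k1\<bar> + 1) (source_const K1) (\<phi> i))"
    using W_target_bound(2)[OF pos(3) D b] by (simp add: prod.distrib mult_ac)
qed

lemma symbol_operator_multilinear:
  fixes F :: "('n::finite \<Rightarrow> hseq) \<Rightarrow> hseq \<Rightarrow> complex"
  assumes F: "O1 F" and bd: "symbol_bound F k K C k1 K1" and pos: "C > 0" "K > 0" "K1 > 0"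
  shows "multilinear_on_W (symbol_operator F)"
  unfolding multilinear_on_W_def
proof (intro allI impI ext)
  fix \<phi> :: "'n \<Rightarrow> fock" and i \<psi> \<theta> a b B
  assume \<phi>: "\<forall>j. \<phi> j \<in> W_inf" and \<psi>: "\<psi> \<in> W_inf" and \<theta>: "\<theta> \<in> W_inf"
  define t where "t \<rho> A = (\<Prod>j\<in>UNIV. (\<phi>(i := \<rho>)) j (A j) * of_nat (mi_fact (A j)))
        * taylor_coef (merged F) (join (case_option B A))" for \<rho> :: fock and A
  have operator_eq: "symbol_operator F (\<phi>(i := \<rho>)) B = (\<Sum>\<^sub>\<infinity>A. t \<rho> A)" for \<rho>
    by (simp only: symbol_operator_def t_def)
  have st: "t \<rho> summable_on UNIV" if "\<rho> \<in> W_inf" for \<rho>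
    unfolding t_def[abs_def]
    by (rule abs_summable_summable, rule symbol_operator_bound(1)[OF F bd pos]) (use \<phi> that in auto)
  \<comment> \<open>Isolates the single factor that depends on slot i, in which the summand is
    linear.\<close>
  have t_eq: "t \<rho> A = \<rho> (A i) * (of_nat (mi_fact (A i)) * (\<Prod>j\<in>UNIV - {i}. \<phi> j (A j) * of_nat (mi_fact (A j)))
      * taylor_coef (merged F) (join (case_option B A)))" for \<rho> A
    unfolding t_def by (subst prod.remove[of UNIV i]) (auto simp: mult_ac)
  have "(\<Sum>\<^sub>\<infinity>A. t (\<lambda>A. a * \<psi> A + b * \<theta> A) A) = (\<Sum>\<^sub>\<infinity>A. a * t \<psi> A + b * t \<theta> A)"
    by (rule infsum_cong) (simp only: t_eq, simp add: algebra_simps)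
  also have "\<dots> = a * infsum (t \<psi>) UNIV + b * infsum (t \<theta>) UNIV"
    by (simp add: infsum_add summable_on_cmult_right st \<psi> \<theta> infsum_cmult_right')
  finally show "symbol_operator F (\<phi>(i := \<lambda>A. a * \<psi> A + b * \<theta> A)) B
      = a * symbol_operator F (\<phi>(i := \<psi>)) B + b * symbol_operator F (\<phi>(i := \<theta>)) B"
    unfolding operator_eq .
qed

text \<open>The symbol is the Taylor series of the merged function at (\<xi>, \<eta>), summed over
  the input multi-indices before the output one. Its absolute summability follows by treating
  \<eta>, like the inputs, as a coherent vector in \<open>W_inf\<close>.\<close>

lemma symbol_operator_symbol:
  fixes F :: "('n::finite \<Rightarrow> hseq) \<Rightarrow> hseq \<Rightarrow> complex"
  assumes F: "O1 F" and bd: "symbol_bound F k K C k1 K1" and pos: "C > 0" "K > 0" "K1 > 0"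
  shows "is_symbol_of F (symbol_operator F)"
  unfolding is_symbol_of_def
proof (intro allI impI)
  fix \<xi> :: "'n \<Rightarrow> hseq" and \<eta> assume \<xi>: "\<forall>i. \<xi> i \<in> H_inf" and \<eta>: "\<eta> \<in> H_inf"
  let ?\<kappa> = "case_option K (\<lambda>_ :: 'n. K1)" and ?k = "case_option (- k) (\<lambda>_ :: 'n. k1)"
  have \<kappa>: "?\<kappa> p > 0" for p using pos by (auto split: option.split)
  interpret gaussian_entire "merged F" "slot_space TYPE('n)" "slot_weight ?\<kappa> ?k" C
    by (rule merged_gaussian_entire[OF F bd]) (use pos in auto)
  define \<zeta> where "\<zeta> = case_option \<eta> \<xi>"
  have \<zeta>: "\<zeta> p \<in> H_inf" for p using \<xi> \<eta> by (auto simp: \<zeta>_def split: option.split)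
  define x where "x = combine \<zeta>"
  have x: "x \<in> slot_space TYPE('n)" by (simp add: x_def slot_space_def \<zeta>)
  have Fx: "merged F x = F \<xi> \<eta>" by (simp add: merged_def x_def \<zeta>_def)
  define m where "m p A = coherent (\<zeta> p) A * of_nat (mi_fact A)" for p A
  define h where "h A = taylor_coef (merged F) (join A) * (\<Prod>p\<in>UNIV. m p (A p))" for A
  have h_eq: "h A = taylor_coef (merged F) (join A) * (\<Prod>v\<in>#join A. x v)" for A
    by (simp add: h_def m_def prod_join x_def coherent_mult_mi_fact)
  define f where "f p A = cmod (coherent (\<zeta> p) A) * mi_fact A * coef_weight (?k p) (?\<kappa> p) A" for p A
  have fs: "f p summable_on UNIV" for p
    unfolding f_def by (rule coef_weight_pairing(1)[OF coherent_W_inf[OF \<zeta>] \<kappa>])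
  have f0: "f p A \<ge> 0" for p A using coef_weight_nonneg[OF \<kappa>] by (simp add: f_def)
  have s: "(\<lambda>A. sqrt C * (\<Prod>p\<in>UNIV. f p (A p))) summable_on UNIV"
    by (intro summable_on_cmult_right prod_fun_summable(1) fs f0)
  have sh: "h summable_on UNIV"
  proof (rule abs_summable_summable, rule summable_on_comparison_test[OF s])
    fix A :: "'n option \<Rightarrow> nat multiset"
    have A: "case_option (A None) (\<lambda>i. A (Some i)) = A" by (auto split: option.split)
    have "norm (h A) = cmod (taylor_coef (merged F) (join A)) * (\<Prod>p\<in>UNIV. cmod (coherent (\<zeta> p) (A p)) * mi_fact (A p))"
      by (simp add: h_def m_def norm_mult prod_norm[symmetric])
    also have "\<dots> \<le> (sqrt C * coef_weight (- k) K (A None) * (\<Prod>i\<in>UNIV. coef_weight k1 K1 (A (Some i))))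
        * (\<Prod>p\<in>UNIV. cmod (coherent (\<zeta> p) (A p)) * mi_fact (A p))"
      using taylor_coef_join_bound[OF F bd pos, of "A None" "\<lambda>i. A (Some i)"] unfolding A
      by (rule mult_right_mono) (auto intro!: prod_nonneg)
    also have "\<dots> = sqrt C * (\<Prod>p\<in>UNIV. f p (A p))"
      by (simp add: f_def prod_option_UNIV prod.distrib mult_ac)
    finally show "norm (h A) \<le> sqrt C * (\<Prod>p\<in>UNIV. f p (A p))" .
  qed simp
  have "(\<lambda>A. taylor_coef (merged F) A * (\<Prod>v\<in>#A. x v)) summable_on UNIV"
    using sh unfolding h_eq[abs_def]
    by (rule summable_on_reindex_bij_betw[OF bij_join, THEN iffD1])
  from taylor_expansion[OF x this]
  have hF: "(h has_sum F \<xi> \<eta>) UNIV"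
    unfolding h_eq[abs_def] Fx by (rule has_sum_reindex_bij_betw[OF bij_join, THEN iffD2])
  \<comment> \<open>Separates the output multi-index from the input ones, so that Fubini yields the
    iterated sum of the pairing.\<close>
  define u where "u = (\<lambda>(B, A :: 'n \<Rightarrow> nat multiset). case_option B A)"
  have u: "bij_betw u (UNIV \<times> UNIV) UNIV"
    by (rule bij_betw_byWitness[where f' = "\<lambda>A. (A None, \<lambda>i. A (Some i))"])
      (auto simp: u_def fun_eq_iff split: option.split)
  have hu: "((\<lambda>q. h (u q)) has_sum F \<xi> \<eta>) (UNIV \<times> UNIV)"
    using hF by (rule has_sum_reindex_bij_betw[OF u, THEN iffD2])
  have "symbol (symbol_operator F) \<xi> \<eta> = (\<Sum>\<^sub>\<infinity>B. \<Sum>\<^sub>\<infinity>A. h (u (B, A)))"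
    unfolding symbol_def pairing_def symbol_operator_def mult.assoc infsum_cmult_left'[symmetric]
    by (intro infsum_cong) (simp add: h_def m_def u_def prod_option_UNIV \<zeta>_def mult_ac)
  also have "\<dots> = infsum (\<lambda>q. h (u q)) (UNIV \<times> UNIV)"
    by (rule infsum_Sigma_banach) (use hu in \<open>auto simp: summable_on_def\<close>)
  also have "\<dots> = F \<xi> \<eta>" using hu by (rule infsumI)
  finally show "F \<xi> \<eta> = symbol (symbol_operator F) \<xi> \<eta>" ..
qed

theorem symbol_operator_O2_data:
  fixes F :: "('n::finite \<Rightarrow> hseq) \<Rightarrow> hseq \<Rightarrow> complex"
  assumes F: "O1 F" and data: "O2_data C k1 K1 F"
  shows "symbol_operator F \<in> L_W" and "is_symbol_of F (symbol_operator F)"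
    and "\<And>k' C'. k' > 0 \<Longrightarrow> C' > 0 \<Longrightarrow> W_bound (symbol_operator F) k' C'
      (\<bar>k1 (k' + 1) (target_const C')\<bar> + 1)
      (source_const (K1 (k' + 1) (target_const C')))
      (sqrt 2 * sqrt (C (k' + 1) (target_const C')) * sqrt 2 ^ CARD('n))"
proof -
  have d: "C k K > 0" "K1 k K > 0" "symbol_bound F k K (C k K) (k1 k K) (K1 k K)" if "k > 0" "K > 0" for k K
    using data that by (auto simp: O2_data_def)
  show bd: "W_bound (symbol_operator F) k' C'
      (\<bar>k1 (k' + 1) (target_const C')\<bar> + 1)
      (source_const (K1 (k' + 1) (target_const C')))
      (sqrt 2 * sqrt (C (k' + 1) (target_const C')) * sqrt 2 ^ CARD('n))"
    if k': "k' > 0" and C': "C' > 0" for k' C'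
    unfolding W_bound_def
    using symbol_operator_target(2)[OF F d(3) d(1) d(2) C'] k' target_const_pos[OF C'] by simp
  have mem: "symbol_operator F \<phi> \<in> W_inf" if "\<forall>i. \<phi> i \<in> W_inf" for \<phi>
    by (rule W_infI, rule symbol_operator_target(1)[OF F d(3) d(1) d(2)])
      (use that target_const_pos in auto)
  have "\<exists>k2>0. \<exists>C2>0. \<exists>K2>0. W_bound (symbol_operator F) k' C' k2 C2 K2" if "k' > 0" "C' > 0" for k' C'
  proof -
    have "\<bar>k1 (k' + 1) (target_const C')\<bar> + 1 > 0" by simp
    moreover have "source_const (K1 (k' + 1) (target_const C')) > 0"
      using that target_const_pos by (intro source_const_pos d) auto
    moreover have "sqrt 2 * sqrt (C (k' + 1) (target_const C')) * sqrt 2 ^ CARD('n) > 0"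
      using that target_const_pos d(1)[of "k' + 1" "target_const C'"] by simp
    ultimately show ?thesis using bd[OF that] by blast
  qed
  then show "symbol_operator F \<in> L_W"
    \<comment> \<open>Multilinearity and the symbol identity concern no particular norm, so one
      instance of \<open>O2\<close>, at k = K = 1, suffices for each.\<close>
    using mem symbol_operator_multilinear[OF F d(3) d(1) _ d(2), of 1 1] by (simp add: L_W_def)
  show "is_symbol_of F (symbol_operator F)"
    by (rule symbol_operator_symbol[OF F d(3) d(1) _ d(2), of 1 1]) auto
qed

theorem theorem2:
  shows "(\<forall>F :: ('n::finite \<Rightarrow> hseq) \<Rightarrow> hseq \<Rightarrow> complex.
            O1 F \<and> O2 F \<longrightarrow> (\<exists>\<Xi>\<in>L_W. is_symbol_of F \<Xi>))
       \<and> (\<forall>C k\<^sub>1 K\<^sub>1 :: real \<Rightarrow> real \<Rightarrow> real. \<exists>k\<^sub>2 C\<^sub>2 K\<^sub>2 :: real \<Rightarrow> real \<Rightarrow> real.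
            (\<forall>k'>0. \<forall>C'>0. k\<^sub>2 k' C' > 0 \<and> C\<^sub>2 k' C' > 0 \<and> K\<^sub>2 k' C' > 0) \<and>
            (\<forall>F :: ('n \<Rightarrow> hseq) \<Rightarrow> hseq \<Rightarrow> complex.
               O1 F \<and> O2_data C k\<^sub>1 K\<^sub>1 F \<longrightarrow>
               (\<exists>\<Xi>\<in>L_W. is_symbol_of F \<Xi> \<and>
                  (\<forall>k'>0. \<forall>C'>0.
                     W_bound \<Xi> k' C' (k\<^sub>2 k' C') (C\<^sub>2 k' C') (K\<^sub>2 k' C')))))"
proof (intro conjI allI impI)
  fix F :: "('n \<Rightarrow> hseq) \<Rightarrow> hseq \<Rightarrow> complex"
  assume F: "O1 F \<and> O2 F"
  then have "\<forall>k K. \<exists>C k1 K1. k > 0 \<longrightarrow> K > 0 \<longrightarrow> C > 0 \<and> k1 > k \<and> K1 > 0 \<and> symbol_bound F k K C k1 K1"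
    unfolding O2_def by metis
  then obtain C k1 K1 where "\<forall>k K. k > 0 \<longrightarrow> K > 0 \<longrightarrow>
      C k K > 0 \<and> k1 k K > k \<and> K1 k K > 0 \<and> symbol_bound F k K (C k K) (k1 k K) (K1 k K)"
    by metis
  then have "O2_data C k1 K1 F" by (simp add: O2_data_def)
  then show "\<exists>\<Xi>\<in>L_W. is_symbol_of F \<Xi>"
    using symbol_operator_O2_data(1,2) F by blast
next
  fix C k1 K1 :: "real \<Rightarrow> real \<Rightarrow> real"
  \<comment> \<open>The constants are quantified before F and may be nonpositive when no F fits
    them, yet the moduli have to be positive in any case; the default 1 takes effect only
    then.\<close>
  define pos where "pos r = (if r > 0 then r else 1)" for r :: real
  define k2 where "k2 k' C' = \<bar>k1 (k' + 1) (target_const C')\<bar> + 1" for k' C'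
  define C2 where "C2 k' C' = source_const (pos (K1 (k' + 1) (target_const C')))" for k' C'
  define K2 where "K2 k' C' = sqrt 2 * sqrt (pos (C (k' + 1) (target_const C'))) * sqrt 2 ^ CARD('n)" for k' C'
  have pos: "pos r > 0" for r by (simp add: pos_def)
  have "\<forall>k'>0. \<forall>C'>0. k2 k' C' > 0 \<and> C2 k' C' > 0 \<and> K2 k' C' > 0"
    by (simp add: k2_def C2_def K2_def source_const_pos pos add_nonneg_pos)
  moreover have "\<exists>\<Xi>\<in>L_W. is_symbol_of F \<Xi> \<and>
      (\<forall>k'>0. \<forall>C'>0. W_bound \<Xi> k' C' (k2 k' C') (C2 k' C') (K2 k' C'))"
    if F: "O1 F" "O2_data C k1 K1 F" for F :: "('n \<Rightarrow> hseq) \<Rightarrow> hseq \<Rightarrow> complex"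
  proof (intro bexI conjI allI impI)
    fix k' C' :: real assume *: "k' > 0" "C' > 0"
    then have "C (k' + 1) (target_const C') > 0" "K1 (k' + 1) (target_const C') > 0"
      using F(2) target_const_pos by (auto simp: O2_data_def)
    then show "W_bound (symbol_operator F) k' C' (k2 k' C') (C2 k' C') (K2 k' C')"
      using symbol_operator_O2_data(3)[OF F *] by (simp add: k2_def C2_def K2_def pos_def)
  qed (use symbol_operator_O2_data(1,2)[OF F] in auto)
  ultimately show "\<exists>k2 C2 K2 :: real \<Rightarrow> real \<Rightarrow> real.
      (\<forall>k'>0. \<forall>C'>0. k2 k' C' > 0 \<and> C2 k' C' > 0 \<and> K2 k' C' > 0) \<and>
      (\<forall>F :: ('n \<Rightarrow> hseq) \<Rightarrow> hseq \<Rightarrow> complex. O1 F \<and> O2_data C k1 K1 F \<longrightarrow>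
         (\<exists>\<Xi>\<in>L_W. is_symbol_of F \<Xi> \<and>
            (\<forall>k'>0. \<forall>C'>0. W_bound \<Xi> k' C' (k2 k' C') (C2 k' C') (K2 k' C'))))"
    by blast
qed

end
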